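(* Let $p,q$ be positive integers, let $A=R_x^{2\pi/p}$ and $B=R_z^{2\pi/q}$, and let $G(p,q)=G(p,1,q)\subset SO(3)$ be the group generated by $A$ and $B$. (i) If $p,q\ge 3$ are odd, then $G(p,q)$ is isomorphic to the free product $\mathbb{Z}_p * \mathbb{Z}_q = \langle \alpha,\beta : \alpha^p,\ \beta^q\rangle$. (ii) If $p\ge 4$ is even and $q\ge 3$ is odd, then $G(p,q)$ has the presentation $\langle \alpha,\beta : \alpha^p,\ \beta^q,\ \alpha^{p/2}\beta\alpha^{p/2}\beta\rangle$. (iii) If $p\ge 4$ is even and $q=2s$ with $s\ge 3$ odd, then $G(p,q)$ has the presentation $\langle \alpha,\beta : \alpha^p,\ \beta^q,\ \alpha^{p/2}\beta\alpha^{p/2}\beta,\ \beta^{q/2}\alpha\beta^{q/2}\alpha\rangle$. (iv) If $4$ divides both $p$ and $q$, then $G(p,1,q)=G(\mathrm{lcm}(p,q),4,1)$ (equality of subgroups of $SO(3)$). In cases (i), (ii) and (iii), the isomorphism between the abstractly presented group and $G(p,q)$ is given by $\alpha\mapsto A$, $\beta\mapsto B$.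
   Context: $R_x^{\theta}, R_y^{\theta}, R_z^{\theta}\in SO(3)$ denote the rotations of Euclidean 3-space by angle $\theta$ (right-hand rule) about the $x$-, $y$- and $z$-axis respectively. For positive integers $p,\ell,q$, $G(p,\ell,q)$ denotes the subgroup of $SO(3)$ generated by $R_x^{2\pi/p}$, $R_y^{2\pi/\ell}$ and $R_z^{2\pi/q}$; and $G(p,q)=G(p,1,q)$ is the subgroup generated by $R_x^{2\pi/p}$ and $R_z^{2\pi/q}$. In a presentation $\langle\text{generators}:\text{relators}\rangle$ each listed relator is set equal to the identity. *)

theory Defs
  imports "HOL-Analysis.Determinants" "HOL-Algebra.Elementary_Groups"
begin

text \<open>A letter \<open>(x, True)\<close> stands for the generator \<open>x\<close> and \<open>(x, False)\<close> for its inverse.\<close>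

type_synonym 'a word = "('a \<times> bool) list"

definition words :: "'a set \<Rightarrow> 'a word set" where
  "words S = lists (S \<times> UNIV)"

text \<open>Two words are equivalent if one can be turned into the other by finitely many insertions and
  deletions of factors \<open>x x\<inverse>\<close>, \<open>x\<inverse> x\<close> (for generators \<open>x\<close>) and of relators.\<close>

inductive_set word_equiv :: "'a set \<Rightarrow> 'a word set \<Rightarrow> ('a word \<times> 'a word) set"
  for S :: "'a set" and R :: "'a word set" where
  refl: "w \<in> words S \<Longrightarrow> (w, w) \<in> word_equiv S R"
| sym: "(v, w) \<in> word_equiv S R \<Longrightarrow> (w, v) \<in> word_equiv S R"
| trans: "(u, v) \<in> word_equiv S R \<Longrightarrow> (v, w) \<in> word_equiv S R \<Longrightarrow> (u, w) \<in> word_equiv S R"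
| cancel: "u \<in> words S \<Longrightarrow> v \<in> words S \<Longrightarrow> x \<in> S \<Longrightarrow>
    (u @ [(x, b), (x, \<not> b)] @ v, u @ v) \<in> word_equiv S R"
| relator: "u \<in> words S \<Longrightarrow> v \<in> words S \<Longrightarrow> r \<in> R \<Longrightarrow> r \<in> words S \<Longrightarrow>
    (u @ r @ v, u @ v) \<in> word_equiv S R"

definition word_class :: "'a set \<Rightarrow> 'a word set \<Rightarrow> 'a word \<Rightarrow> 'a word set" where
  "word_class S R w = word_equiv S R `` {w}"

definition presented_group :: "'a set \<Rightarrow> 'a word set \<Rightarrow> 'a word set monoid" where
  "presented_group S R =
    \<lparr>carrier = words S // word_equiv S R,
     monoid.mult = (\<lambda>X Y. \<Union>u\<in>X. \<Union>v\<in>Y. word_class S R (u @ v)),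
     one = word_class S R []\<rparr>"

text \<open>\<open>G\<close> has the presentation with generators \<open>S\<close> and relators \<open>R\<close>,
  the isomorphism being given on generators by \<open>f\<close>.\<close>

definition has_presentation_via ::
    "('g, 'm) monoid_scheme \<Rightarrow> 'a set \<Rightarrow> 'a word set \<Rightarrow> ('a \<Rightarrow> 'g) \<Rightarrow> bool" where
  "has_presentation_via G S R f \<longleftrightarrow>
    (\<exists>h \<in> iso (presented_group S R) G. \<forall>x\<in>S. h (word_class S R [(x, True)]) = f x)"

lemma equiv_word_equiv: "equiv (words S) (word_equiv S R)"
proof (rule equivI)
  have "v \<in> words S \<and> w \<in> words S" if "(v, w) \<in> word_equiv S R" for v w
    using that by induction (auto simp: words_def)
  then show "word_equiv S R \<subseteq> words S \<times> words S" by auto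
  show "refl_on (words S) (word_equiv S R)"
    by (auto simp: refl_on_def intro: word_equiv.refl)
  show "sym (word_equiv S R)"
    by (auto intro: symI word_equiv.sym)
  show "trans (word_equiv S R)"
    by (auto intro: transI word_equiv.trans)
qed

lemma word_equiv_append:
  assumes "(v, w) \<in> word_equiv S R" "a \<in> words S" "b \<in> words S"
  shows "(a @ v @ b, a @ w @ b) \<in> word_equiv S R"
  using assms(1)
proof induction
  case (refl w)
  then show ?case using assms by (intro word_equiv.refl) (auto simp: words_def)
next
  case (sym v w)
  then show ?case by (blast intro: word_equiv.sym)
next
  case (trans u v w)
  then show ?case by (blast intro: word_equiv.trans)
next
  case (cancel u v x c)
  then have "((a @ u) @ [(x, c), (x, \<not> c)] @ (v @ b), (a @ u) @ (v @ b)) \<in> word_equiv S R"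
    using assms by (intro word_equiv.cancel) (auto simp: words_def)
  then show ?case by simp
next
  case (relator u v r)
  then have "((a @ u) @ r @ (v @ b), (a @ u) @ (v @ b)) \<in> word_equiv S R"
    using assms by (intro word_equiv.relator) (auto simp: words_def)
  then show ?case by simp
qed

lemma mult_word_class:
  assumes "u \<in> words S" "v \<in> words S"
  shows "word_class S R u \<otimes>\<^bsub>presented_group S R\<^esub> word_class S R v = word_class S R (u @ v)"
proof -
  note eq = equiv_word_equiv[of S R]
  have "congruent2 (word_equiv S R) (word_equiv S R) (\<lambda>u v. word_class S R (u @ v))"
  proof (rule congruent2I[OF eq eq])
    fix y z w assume "w \<in> words S" "(y, z) \<in> word_equiv S R"
    then have "(y @ w, z @ w) \<in> word_equiv S R" "(w @ y, w @ z) \<in> word_equiv S R"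
      using word_equiv_append[of y z S R "[]" w] word_equiv_append[of y z S R w "[]"]
      by (auto simp: words_def)
    then show "word_class S R (y @ w) = word_class S R (z @ w)"
      "word_class S R (w @ y) = word_class S R (w @ z)"
      unfolding word_class_def by (simp_all add: equiv_class_eq[OF eq])
  qed
  then show ?thesis
    using UN_equiv_class2[OF eq eq _ assms]
    by (simp add: presented_group_def word_class_def)
qed

lemma carrier_presented_group: "carrier (presented_group S R) = word_class S R ` words S"
  by (auto simp: presented_group_def quotient_def word_class_def)

lemma one_presented_group: "\<one>\<^bsub>presented_group S R\<^esub> = word_class S R []"
  by (simp add: presented_group_def)

lemma word_inverse_exists:
  assumes "w \<in> words S"
  shows "\<exists>v\<in>words S. (v @ w, []) \<in> word_equiv S R"
  using assms
proof (induction w)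
  case Nil
  then show ?case by (intro bexI[of _ "[]"]) (auto simp: words_def intro: word_equiv.refl)
next
  case (Cons l w)
  obtain x b where l: "l = (x, b)" by force
  have x: "x \<in> S" and w: "w \<in> words S" using Cons.prems l by (auto simp: words_def)
  obtain v where v: "v \<in> words S" "(v @ w, []) \<in> word_equiv S R" using Cons.IH w by blast
  have "(v @ [(x, \<not> b), (x, \<not> \<not> b)] @ w, v @ w) \<in> word_equiv S R"
    using v w x by (intro word_equiv.cancel)
  then have "((v @ [(x, \<not> b)]) @ l # w, []) \<in> word_equiv S R"
    using v(2) l word_equiv.trans by fastforce
  moreover have "v @ [(x, \<not> b)] \<in> words S" using v(1) x by (auto simp: words_def)
  ultimately show ?case by blast
qed

lemma group_presented_group: "group (presented_group S R)"
proof (rule groupI)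
  have app: "u @ v \<in> words S" if "u \<in> words S" "v \<in> words S" for u v :: "'a word"
    using that by (auto simp: words_def)
  have nil: "[] \<in> words S" by (simp add: words_def)
  note simps = carrier_presented_group one_presented_group mult_word_class app nil
  show "\<one>\<^bsub>presented_group S R\<^esub> \<in> carrier (presented_group S R)" using nil by (auto simp: simps)
  fix x assume x: "x \<in> carrier (presented_group S R)"
  then show "\<one>\<^bsub>presented_group S R\<^esub> \<otimes>\<^bsub>presented_group S R\<^esub> x = x" by (auto simp: simps)
  obtain w where w: "w \<in> words S" "x = word_class S R w" using x by (auto simp: simps)
  obtain v where v: "v \<in> words S" "(v @ w, []) \<in> word_equiv S R"
    using word_inverse_exists[OF w(1)] by blast
  have "word_class S R (v @ w) = word_class S R []"
    unfolding word_class_def using equiv_class_eq[OF equiv_word_equiv v(2)] .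
  then show "\<exists>y\<in>carrier (presented_group S R). y \<otimes>\<^bsub>presented_group S R\<^esub> x = \<one>\<^bsub>presented_group S R\<^esub>"
    using v(1) w by (intro bexI[of _ "word_class S R v"]) (auto simp: simps)
  fix y assume y: "y \<in> carrier (presented_group S R)"
  then show "x \<otimes>\<^bsub>presented_group S R\<^esub> y \<in> carrier (presented_group S R)"
    using x by (auto simp: simps)
  fix z assume "z \<in> carrier (presented_group S R)"
  then show "x \<otimes>\<^bsub>presented_group S R\<^esub> y \<otimes>\<^bsub>presented_group S R\<^esub> z =
      x \<otimes>\<^bsub>presented_group S R\<^esub> (y \<otimes>\<^bsub>presented_group S R\<^esub> z)"
    using x y by (auto simp: simps)
qed

text \<open>The relators are the multiplication tables of the two factors.\<close>

definition free_product ::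
    "('a, 'm) monoid_scheme \<Rightarrow> ('b, 'n) monoid_scheme \<Rightarrow> ('a + 'b) word set monoid" where
  "free_product G H = presented_group (carrier G <+> carrier H)
    ({[(Inl x, True), (Inl y, True), (Inl (x \<otimes>\<^bsub>G\<^esub> y), False)] | x y. x \<in> carrier G \<and> y \<in> carrier G} \<union>
     {[(Inr x, True), (Inr y, True), (Inr (x \<otimes>\<^bsub>H\<^esub> y), False)] | x y. x \<in> carrier H \<and> y \<in> carrier H})"

definition SO3 :: "(real^3^3) monoid" where
  "SO3 = \<lparr>carrier = {Q. rotation_matrix Q}, monoid.mult = (**), one = mat 1\<rparr>"

text \<open>The matrices below, given by their rows, act on column vectors and are counterclockwise when
  seen from the positive end of the axis.\<close>

definition rot_x :: "real \<Rightarrow> real^3^3" where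
  "rot_x \<theta> = vector [vector [1, 0, 0],
                     vector [0, cos \<theta>, - sin \<theta>],
                     vector [0, sin \<theta>, cos \<theta>]]"

definition rot_y :: "real \<Rightarrow> real^3^3" where
  "rot_y \<theta> = vector [vector [cos \<theta>, 0, sin \<theta>],
                     vector [0, 1, 0],
                     vector [- sin \<theta>, 0, cos \<theta>]]"

definition rot_z :: "real \<Rightarrow> real^3^3" where
  "rot_z \<theta> = vector [vector [cos \<theta>, - sin \<theta>, 0],
                     vector [sin \<theta>, cos \<theta>, 0],
                     vector [0, 0, 1]]"

definition rot_group :: "nat \<Rightarrow> nat \<Rightarrow> nat \<Rightarrow> (real^3^3) set" where
  "rot_group p l q = generate SO3 {rot_x (2 * pi / real p), rot_y (2 * pi / real l), rot_z (2 * pi / real q)}"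

lemma group_SO3: "group SO3"
proof (rule groupI)
  fix Q assume "Q \<in> carrier SO3"
  then have Q: "rotation_matrix Q" by (simp add: SO3_def)
  then have "rotation_matrix (transpose Q)" "transpose Q ** Q = mat 1"
    by (auto simp: rotation_matrix_def orthogonal_matrix_def det_transpose)
  then show "\<exists>P\<in>carrier SO3. P \<otimes>\<^bsub>SO3\<^esub> Q = \<one>\<^bsub>SO3\<^esub>"
    by (auto simp: SO3_def)
qed (auto simp: SO3_def rotation_matrix_def orthogonal_matrix_mul orthogonal_matrix_id det_mul
       matrix_mul_assoc)

lemma rot_in_SO3: "rot_x \<theta> \<in> carrier SO3" "rot_y \<theta> \<in> carrier SO3" "rot_z \<theta> \<in> carrier SO3"
proof -
  have "sin \<theta> * sin \<theta> + cos \<theta> * cos \<theta> = 1"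
    using sin_cos_squared_add[of \<theta>] by (simp add: power2_eq_square)
  then show "rot_x \<theta> \<in> carrier SO3" "rot_y \<theta> \<in> carrier SO3" "rot_z \<theta> \<in> carrier SO3"
    by (auto simp: SO3_def rotation_matrix_def orthogonal_matrix rot_x_def rot_y_def rot_z_def
        vec_eq_iff forall_3 matrix_matrix_mult_def transpose_def mat_def sum_3 det_3 add.commute)
qed

lemma subgroup_rot_group: "subgroup (rot_group p l q) SO3"
  unfolding rot_group_def
  by (rule group.generate_is_subgroup[OF group_SO3]) (auto simp: rot_in_SO3)

lemma rot_group_two_generators:
  "rot_group p 1 q = generate SO3 {rot_x (2 * pi / real p), rot_z (2 * pi / real q)}"
proof -
  have "rot_y (2 * pi) = \<one>\<^bsub>SO3\<^esub>"
    by (simp add: rot_y_def SO3_def vec_eq_iff forall_3 mat_def)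
  moreover have "generate SO3 (insert \<one>\<^bsub>SO3\<^esub> X) = generate SO3 X" if X: "X \<subseteq> carrier SO3" for X
  proof
    show "generate SO3 (insert \<one>\<^bsub>SO3\<^esub> X) \<subseteq> generate SO3 X"
      using X by (intro group.generate_subgroup_incl[OF group_SO3] group.generate_is_subgroup[OF group_SO3])
        (auto intro: generate.one generate.incl)
    show "generate SO3 X \<subseteq> generate SO3 (insert \<one>\<^bsub>SO3\<^esub> X)"
      by (rule group.mono_generate[OF group_SO3]) auto
  qed
  ultimately show ?thesis
    by (simp add: rot_group_def insert_commute rot_in_SO3)
qed

datatype generator = Alpha | Beta

definition gen_pow :: "'a \<Rightarrow> nat \<Rightarrow> 'a word" where
  "gen_pow x n = replicate n (x, True)"

end

(* Choose a valuation ring V of the reals with 2 in its maximal ideal M.  If \<theta> is a rational multiple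
   of pi with sin (2 * \<theta>) \<noteq> 0, then cos \<theta> is not in V, so that 1 / cos \<theta> is in M and tan \<theta> is 1
   modulo M: divided by its cosine, the rotation by \<theta> about a coordinate axis reduces modulo M to a
   matrix of rank one.  The reductions for the x- and the z-axis have nonorthogonal ranges, and a quarter
   turn about the x-axis, which is integral, does not change this.  Hence denominators accumulate in an
   alternating product that contains a rotation about the z-axis, and such a product is not one of the
   diagonal matrices coming from half turns.  On the other side, the relators allow to write each
   element of the presented group as a product of at most two half turns followed by an alternating
   product of nontrivial powers of the generators.  When 4 divides p and q, all three quarter turns are
   in the group; they conjugate the axes into each other, and the rest is Bezout's identity. *)
theory Submission
  imports Defs "HOL-Computational_Algebra.Polynomial"
begin

section \<open>A valuation ring of the reals above 2\<close>

definition real_subring :: "real set \<Rightarrow> bool" where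
  "real_subring V \<longleftrightarrow> 1 \<in> V \<and> (\<forall>x\<in>V. \<forall>y\<in>V. x - y \<in> V \<and> x * y \<in> V)"

lemma real_subringD:
  assumes "real_subring V"
  shows "1 \<in> V" "0 \<in> V" "x \<in> V \<Longrightarrow> y \<in> V \<Longrightarrow> x - y \<in> V" "x \<in> V \<Longrightarrow> y \<in> V \<Longrightarrow> x * y \<in> V"
    "x \<in> V \<Longrightarrow> - x \<in> V" "x \<in> V \<Longrightarrow> y \<in> V \<Longrightarrow> x + y \<in> V" "x \<in> V \<Longrightarrow> x ^ n \<in> V" "numeral k \<in> V"
    "(\<And>i. i \<in> I \<Longrightarrow> f i \<in> V) \<Longrightarrow> sum f I \<in> V"
proof -
  show one: "1 \<in> V" and diff: "\<And>x y. x \<in> V \<Longrightarrow> y \<in> V \<Longrightarrow> x - y \<in> V"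
    and mult: "\<And>x y. x \<in> V \<Longrightarrow> y \<in> V \<Longrightarrow> x * y \<in> V"
    using assms by (auto simp: real_subring_def)
  show zero: "0 \<in> V" using diff[OF one one] by simp
  show neg: "- x \<in> V" if "x \<in> V" for x using diff[OF zero that] by simp
  show add: "x + y \<in> V" if "x \<in> V" "y \<in> V" for x y using diff[OF that(1) neg[OF that(2)]] by simp
  show "x ^ n \<in> V" if "x \<in> V" for x by (induction n) (auto simp: one mult that)
  show "numeral k \<in> V"
    by (induction k) (auto simp only: numeral.simps intro!: one add)
  show "sum f I \<in> V" if "\<And>i. i \<in> I \<Longrightarrow> f i \<in> V" for f :: "'a \<Rightarrow> real" and I
    using that by (induction I rule: infinite_finite_induct) (auto simp: zero add)
qed

definition adjoin :: "real set \<Rightarrow> real \<Rightarrow> real set" where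
  "adjoin V x = {poly f x | f. \<forall>i. coeff f i \<in> V}"

lemma real_subring_adjoin:
  assumes "real_subring V"
  shows "real_subring (adjoin V x)" "V \<subseteq> adjoin V x" "x \<in> adjoin V x"
proof -
  note V = real_subringD[OF assms]
  have "poly f x - poly g x \<in> adjoin V x \<and> poly f x * poly g x \<in> adjoin V x"
    if "\<forall>i. coeff f i \<in> V" "\<forall>i. coeff g i \<in> V" for f g
  proof
    show "poly f x - poly g x \<in> adjoin V x"
      unfolding adjoin_def mem_Collect_eq using that V by (intro exI[of _ "f - g"]) simp
    show "poly f x * poly g x \<in> adjoin V x"
      unfolding adjoin_def mem_Collect_eq using that by (intro exI[of _ "f * g"]) (auto simp: coeff_mult intro!: V)
  qed
  moreover have 1: "V \<subseteq> adjoin V x"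
  proof
    fix y assume "y \<in> V"
    then show "y \<in> adjoin V x"
      unfolding adjoin_def mem_Collect_eq using V by (intro exI[of _ "[:y:]"]) (simp add: coeff_pCons split: nat.split)
  qed
  ultimately show "real_subring (adjoin V x)"
    using V(1) unfolding real_subring_def by (fastforce simp: adjoin_def[of V x])
  show "V \<subseteq> adjoin V x" by fact
  show "x \<in> adjoin V x"
    unfolding adjoin_def mem_Collect_eq using V by (intro exI[of _ "[:0, 1:]"]) (simp add: coeff_pCons split: nat.split)
qed

text \<open>\<open>total\<close> makes \<open>V\<close> a valuation ring with fraction field the
  reals; \<open>half\<close> says that 2 is not a unit, so \<open>V\<close> meets the rationals in
  their localization at 2.\<close>

locale dyadic_valuation_ring =
  fixes V :: "real set"
  assumes subring: "real_subring V"
    and half: "1 / 2 \<notin> V"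
    and total: "x \<in> V \<or> inverse x \<in> V"

text \<open>A subring of the reals that is maximal among those not containing \<open>1 / 2\<close> is a valuation ring.\<close>

lemma dyadic_valuation_ring_exists: "\<exists>V. dyadic_valuation_ring V"
proof -
  define S where "S = {V. real_subring V \<and> 1 / 2 \<notin> V}"
  have "(1 / 2 :: real) \<notin> \<int>"
  proof
    assume "(1 / 2 :: real) \<in> \<int>"
    then obtain k where "(1 / 2 :: real) = of_int k" by (rule Ints_cases)
    then have "of_int (2 * k) = (of_int 1 :: real)" by simp
    then have "2 * k = 1" by (simp only: of_int_eq_iff)
    then show False by presburger
  qed
  then have "\<int> \<in> S" by (auto simp: S_def real_subring_def)
  moreover have "\<Union>C \<in> S" if C: "C \<noteq> {}" "subset.chain S C" for C
  proof -
    have sub: "\<And>W. W \<in> C \<Longrightarrow> real_subring W" "1 / 2 \<notin> \<Union>C"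
      using C(2) by (auto simp: subset.chain_def S_def)
    have "x - y \<in> \<Union>C \<and> x * y \<in> \<Union>C" if xy: "x \<in> \<Union>C" "y \<in> \<Union>C" for x y
    proof -
      obtain X Y where XY: "X \<in> C" "Y \<in> C" "x \<in> X" "y \<in> Y" using xy by blast
      then have "X \<subseteq> Y \<or> Y \<subseteq> X" using C(2) by (auto simp: subset.chain_def)
      then obtain Z where "Z \<in> C" "x \<in> Z" "y \<in> Z" using XY by blast
      then show ?thesis using real_subringD[OF sub(1)] by blast
    qed
    moreover have "1 \<in> \<Union>C" using C(1) real_subringD(1)[OF sub(1)] by blast
    ultimately show ?thesis using sub(2) by (simp add: S_def real_subring_def)
  qed
  ultimately obtain V where VS: "V \<in> S" and max: "\<And>W. W \<in> S \<Longrightarrow> V \<subseteq> W \<Longrightarrow> W = V"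
    using subset_Zorn_nonempty[of S] by blast
  have sub: "real_subring V" and half: "1 / 2 \<notin> V" using VS by (auto simp: S_def)
  note V = real_subringD[OF sub]
  \<comment> \<open>Maximality: adjoining an element outside \<open>V\<close> brings in 1/2, so 1 is
    twice a polynomial expression in that element.\<close>
  have adj: "\<exists>f. (\<forall>i. coeff f i \<in> V) \<and> 2 * poly f x = 1" if "x \<notin> V" for x
  proof -
    have "adjoin V x \<notin> S" using real_subring_adjoin[OF sub, of x] max[of "adjoin V x"] that by auto
    then have "1 / 2 \<in> adjoin V x" using real_subring_adjoin(1)[OF sub] by (auto simp: S_def)
    then obtain f where "1 / 2 = poly f x" "\<forall>i. coeff f i \<in> V" by (auto simp: adjoin_def)
    then show ?thesis by (intro exI[of _ f]) auto
  qed
  \<comment> \<open>Elements congruent to 1 modulo 2V are units. Otherwise \<open>adj\<close> for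
    1/u, multiplied by a power of u, puts that power into 2V; it is also congruent to 1 modulo 2V,
    and 1/2 would be in \<open>V\<close>.\<close>
  have unit: "inverse u \<in> V" if r: "r \<in> V" and u: "u = 1 - 2 * r" for u r
  proof (rule ccontr)
    assume "inverse u \<notin> V"
    then obtain f where f: "\<And>i. coeff f i \<in> V" "2 * poly f (inverse u) = 1" using adj by blast
    have u0: "u \<noteq> 0"
    proof
      assume "u = 0"
      then have "r = 1 / 2" using u by simp
      then show False using half r by metis
    qed
    have uV: "u \<in> V" using u V r by simp
    have "2 * poly (reflect_poly f) u = u ^ degree f"
      using f(2) u0 by (simp add: poly_reflect_poly_nz)
    moreover have "poly (reflect_poly f) u \<in> V"
      unfolding poly_altdef by (intro V uV) (auto simp: coeff_reflect_poly f(1) V)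
    ultimately obtain s where s: "s \<in> V" "u ^ degree f = 2 * s" by metis
    have "\<exists>t\<in>V. u ^ n = 1 - 2 * t" for n
    proof (induction n)
      case 0 show ?case by (intro bexI[of _ 0]) (auto simp: V)
    next
      case (Suc n)
      then obtain t where t: "t \<in> V" "u ^ n = 1 - 2 * t" by blast
      have "u ^ Suc n = (1 - 2 * r) * (1 - 2 * t)" by (simp only: power_Suc t(2) u[symmetric])
      then have "u ^ Suc n = 1 - 2 * (t + r - 2 * t * r)" by (simp add: algebra_simps)
      moreover have "t + r - 2 * t * r \<in> V" using t r V by simp
      ultimately show ?case by blast
    qed
    then obtain t where t: "t \<in> V" "u ^ degree f = 1 - 2 * t" by blast
    then have "1 / 2 = s + t" using s by simp
    then show False using half V(6)[OF s(1) t(1)] by metis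
  qed
  have total: "x \<in> V \<or> inverse x \<in> V" for x
  proof (rule ccontr)
    assume neg: "\<not> (x \<in> V \<or> inverse x \<in> V)"
    define P where "P y f \<longleftrightarrow> (\<forall>i. coeff f i \<in> V) \<and> 2 * poly f y = 1" for y f
    have ex: "\<exists>f. P x f" "\<exists>f. P (inverse x) f" using adj neg by (auto simp: P_def)
    obtain f1 where f1: "P x f1" "\<And>g. P x g \<Longrightarrow> degree f1 \<le> degree g"
      using ex_has_least_nat[of "P x" _ degree] ex(1) by blast
    obtain f2 where f2: "P (inverse x) f2" "\<And>g. P (inverse x) g \<Longrightarrow> degree f2 \<le> degree g"
      using ex_has_least_nat[of "P (inverse x)" _ degree] ex(2) by blast
    \<comment> \<open>Chevalley's degree argument: a relation \<open>f\<close> of minimal degree for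
      \<open>y\<close> is shortened by a relation \<open>g\<close> for 1/y of at most that degree.
      By symmetry this covers both orders of the two minimal degrees.\<close>
    have False if y: "y \<notin> V" and f: "P y f" and min: "\<And>h. P y h \<Longrightarrow> degree f \<le> degree h"
      and g: "P (inverse y) g" and le: "degree g \<le> degree f" for y f g
    proof -
      define m n where "m = degree g" and "n = degree f"
      have y0: "y \<noteq> 0" using y V by auto
      have "n \<noteq> 0"
      proof
        assume "n = 0"
        then obtain c where "f = [:c:]" by (auto simp: n_def elim: degree_eq_zeroE)
        then have "1 / 2 = c" "c \<in> V" using f by (auto simp: P_def dest: spec[of _ 0])
        then show False using half by metis
      qed
      define u where "u = inverse (1 - 2 * coeff g 0)"
      have uV: "u \<in> V" using unit[of "coeff g 0"] g by (auto simp: u_def P_def)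
      have u1: "u * (1 - 2 * coeff g 0) = 1"
      proof -
        have "1 - 2 * coeff g 0 \<noteq> 0"
        proof
          assume "1 - 2 * coeff g 0 = 0"
          then have "1 / 2 = coeff g 0" by simp
          then show False using half g unfolding P_def by metis
        qed
        then show ?thesis by (simp add: u_def)
      qed
      \<comment> \<open>Multiply 2 g(1/y) = 1 by y^m. The constant coefficient of \<open>g\<close>
        becomes the coefficient of y^m; moving that term to the other side and dividing by the unit
        \<open>1 - 2 * coeff g 0\<close> expresses y^m by lower powers of \<open>y\<close>.\<close>
      define k where "k = smult (2 * u) (reflect_poly g - monom (coeff g 0) m)"
      have "2 * poly (reflect_poly g) y = y ^ m"
        using g y0 by (simp add: P_def m_def poly_reflect_poly_nz)
      then have "poly k y = u * (1 - 2 * coeff g 0) * y ^ m"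
        by (simp add: k_def poly_monom algebra_simps)
      then have ky: "poly k y = y ^ m" using u1 by simp
      have kV: "coeff k i \<in> V" for i
        using g uV V by (auto simp: k_def coeff_reflect_poly P_def)
      have kd: "coeff k i = 0" if "m \<le> i" for i
        using that by (auto simp: k_def coeff_reflect_poly m_def)
      \<comment> \<open>The leading monomial of \<open>f\<close> is rewritten by y^n = y^(n - m) *
        k(y), which leaves only powers below n.\<close>
      define f' where "f' = f - monom (coeff f n) n + monom (coeff f n) (n - m) * k"
      have mn: "m \<le> n" using le by (simp add: m_def n_def)
      then have "poly f' y = poly f y"
        by (simp add: f'_def poly_monom ky flip: power_add)
      moreover have "coeff f' i \<in> V" for i
        using f V kV by (auto simp: f'_def coeff_monom_mult P_def)
      ultimately have "P y f'" using f by (simp add: P_def)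
      then have "n \<le> degree f'" using min by (simp add: n_def)
      moreover have "degree f' \<le> n - 1"
      proof (rule degree_le, intro allI impI)
        fix i assume "n - 1 < i"
        then have i: "n \<le> i" by simp
        then have "coeff (monom (coeff f n) (n - m) * k) i = 0"
          using mn by (auto simp: coeff_monom_mult intro!: kd)
        then show "coeff f' i = 0"
          using i by (cases "i = n") (auto simp: f'_def n_def coeff_eq_0)
      qed
      ultimately show False using \<open>n \<noteq> 0\<close> by simp
    qed
    from this[of x f1 f2] this[of "inverse x" f2 f1] show False using neg f1 f2 nat_le_linear[of "degree f1" "degree f2"] by auto
  qed
  show ?thesis using sub half total by (auto simp: dyadic_valuation_ring_def)
qed

section \<open>Rotations modulo the valuation\<close>

context dyadic_valuation_ring
begin

section \<open>The maximal ideal of the valuation ring\<close>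

lemmas V = real_subringD[OF subring]

text \<open>By \<open>total\<close> these elements belong to \<open>V\<close>, so they are exactly
  its nonunits.\<close>

definition M :: "real set" where
  "M = {x. x = 0 \<or> inverse x \<notin> V}"

lemma M_subset: "x \<in> M \<Longrightarrow> x \<in> V"
  using total V(2) by (auto simp: M_def)

lemma not_in_VD: "x \<notin> V \<Longrightarrow> inverse x \<in> M"
  by (auto simp: M_def)

lemma mult_M: "x \<in> V \<Longrightarrow> y \<in> M \<Longrightarrow> x * y \<in> M"
proof -
  assume x: "x \<in> V" and y: "y \<in> M"
  have "inverse y \<in> V" if "x \<noteq> 0" "inverse (x * y) \<in> V"
  proof -
    have "x * inverse (x * y) = inverse y" using that(1) by simp
    then show ?thesis using V(4)[OF x that(2)] by metis
  qed
  then show ?thesis using y unfolding M_def by auto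
qed

lemma one_notin_M: "1 \<notin> M"
  using V(1) by (auto simp: M_def)

lemma two_in_M: "2 \<in> M"
  using half by (auto simp: M_def inverse_eq_divide)

text \<open>Of two nonzero elements one divides the other in \<open>V\<close>, and the sum is a
  \<open>V\<close>-multiple of the divisor.\<close>

lemma add_M:
  assumes "x \<in> M" "y \<in> M"
  shows "x + y \<in> M"
proof -
  have *: "x + y \<in> M" if "x \<in> M" "y \<noteq> 0" "x / y \<in> V" "y \<in> M" for x y
  proof -
    have "(x / y + 1) * y \<in> M" using that V(1) by (intro mult_M V) auto
    then show ?thesis using that by (simp add: distrib_right)
  qed
  have "x / y \<in> V \<or> y / x \<in> V" using total[of "x / y"] by simp
  then show ?thesis
    using *[of x y] *[of y x] assms by (cases "x = 0 \<or> y = 0") (auto simp: add.commute)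
qed

lemma uminus_M: "x \<in> M \<Longrightarrow> - x \<in> M"
  using mult_M[of "- 1" x] V(1,5) by simp

lemma diff_M: "x \<in> M \<Longrightarrow> y \<in> M \<Longrightarrow> x - y \<in> M"
  using add_M[OF _ uminus_M, of x y] by simp

lemma power2_M: "x\<^sup>2 \<in> M \<Longrightarrow> x \<in> M"
  using V(4)[of "inverse x" "inverse x"] by (auto simp: M_def power2_eq_square)

text \<open>An instance of valuation rings being integrally closed: otherwise 1/x is in
  \<open>M\<close>, and x is the product of x^2 and 1/x.\<close>

lemma power2_V: "x\<^sup>2 \<in> V \<Longrightarrow> x \<in> V"
proof (rule ccontr)
  assume x: "x\<^sup>2 \<in> V" "x \<notin> V"
  then have "inverse x \<in> M" by (intro not_in_VD)
  then have "x\<^sup>2 * inverse x \<in> V" using x(1) M_subset V(4) by blast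
  then show False using x(2) V(2) by (cases "x = 0") (auto simp: power2_eq_square mult.assoc)
qed

section \<open>Rational multiples of pi whose cosine lies in the valuation ring\<close>

lemma cos_multiple_in_V:
  assumes "cos \<theta> \<in> V"
  shows "cos (real n * \<theta>) \<in> V"
proof (induction n rule: induct_nat_012)
  case (ge2 n)
  \<comment> \<open>Chebyshev's recursion has integer coefficients and so stays inside the
    subring.\<close>
  have "cos (real (Suc (Suc n)) * \<theta>) = 2 * cos \<theta> * cos (real (Suc n) * \<theta>) - cos (real n * \<theta>)"
    using cos_add[of "real (Suc n) * \<theta>" \<theta>] cos_diff[of "real (Suc n) * \<theta>" \<theta>]
    by (simp add: algebra_simps)
  then show ?case using assms ge2 V by simp
qed (use assms V in auto)

text \<open>At a nontrivial angle of odd order \<open>2 * m + 1\<close> the Dirichlet kernel \<open>1 + 2 * (\<Sum>k=1..m. cos (k * \<theta>))\<close>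
  vanishes, so \<open>1 / 2\<close> would be in \<open>V\<close> if \<open>cos \<theta>\<close> were.\<close>

lemma cos_in_V_odd_order:
  assumes "cos \<theta> \<in> V" "real (2 * m + 1) * \<theta> = 2 * pi * of_int j"
  shows "sin (\<theta> / 2) = 0"
proof (rule ccontr)
  assume nz: "sin (\<theta> / 2) \<noteq> 0"
  \<comment> \<open>Times sin(\<theta>/2) the kernel telescopes: each cosine becomes a difference of
    sines at consecutive odd multiples of \<theta>/2.\<close>
  have "sin (\<theta> / 2) * (1 + 2 * (\<Sum>k=1..m. cos (real k * \<theta>))) = sin (real (2 * m + 1) * \<theta> / 2)"
  proof (induction m)
    case (Suc m)
    have "2 * sin (\<theta> / 2) * cos (real (Suc m) * \<theta>)
        = sin (real (Suc m) * \<theta> + \<theta> / 2) - sin (real (Suc m) * \<theta> - \<theta> / 2)"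
      by (simp add: sin_add sin_diff)
    also have "real (Suc m) * \<theta> + \<theta> / 2 = real (2 * Suc m + 1) * \<theta> / 2"
      by (simp add: field_simps)
    also have "real (Suc m) * \<theta> - \<theta> / 2 = real (2 * m + 1) * \<theta> / 2"
      by (simp add: field_simps)
    finally show ?case using Suc by (simp add: algebra_simps)
  qed simp
  also have "\<dots> = sin (of_int j * pi)" by (simp only: assms(2)) (simp add: mult.commute)
  also have "\<dots> = 0" by (simp add: sin_zero_iff_int2)
  finally have "1 / 2 = - (\<Sum>k=1..m. cos (real k * \<theta>))" using nz by simp
  then show False
    using half V(5)[OF V(9)[of "{1..m}" "\<lambda>k. cos (real k * \<theta>)"]] cos_multiple_in_V[OF assms(1)] by metis
qed

text \<open>For even order pass to 2\<theta>, which has half the order: then sin(4\<theta>) = 0, and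
  the alternative cos(2\<theta>) = 0 would put cos(\<theta>)^2 = 1/2 into \<open>V\<close>. Odd
  order is \<open>cos_in_V_odd_order\<close>.\<close>

lemma cos_in_V_imp:
  assumes "cos \<theta> \<in> V" "n > 0" "real n * \<theta> = 2 * pi * of_int j"
  shows "sin (2 * \<theta>) = 0"
  using assms
proof (induction n arbitrary: \<theta> rule: less_induct)
  case (less n)
  show ?case
  proof (cases "even n")
    case True
    then obtain m where m: "n = 2 * m" by blast
    have c2: "cos (2 * \<theta>) \<in> V" using cos_multiple_in_V[OF less.prems(1), of 2] by simp
    have "sin (2 * (2 * \<theta>)) = 0"
      using less.prems m c2 by (intro less.IH[of m]) (auto simp: algebra_simps)
    moreover have "cos (2 * \<theta>) \<noteq> 0"
    proof
      assume "cos (2 * \<theta>) = 0"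
      then have "1 / 2 = (cos \<theta>)\<^sup>2" by (simp add: cos_double_cos)
      then show False using half V(7)[OF less.prems(1), of 2] by metis
    qed
    ultimately show ?thesis using sin_double[of "2 * \<theta>"] by simp
  next
    case False
    then obtain m where "n = 2 * m + 1" by (auto elim: oddE)
    then have "sin (\<theta> / 2) = 0" using less.prems cos_in_V_odd_order by blast
    then have "sin \<theta> = 0" using sin_double[of "\<theta> / 2"] by simp
    then show ?thesis by (simp add: sin_double)
  qed
qed

text \<open>1 + tan^2 = sec^2 lies in \<open>M\<close>, so tan is integral; as 2 is in
  \<open>M\<close>, so is (tan - 1)^2 = sec^2 - 2 tan.\<close>

lemma tan_cong_one:
  assumes "cos \<theta> \<notin> V"
  shows "inverse (cos \<theta>) \<in> M" "cos \<theta> \<noteq> 0" "tan \<theta> \<in> V" "tan \<theta> - 1 \<in> M"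
proof -
  show sec: "inverse (cos \<theta>) \<in> M" using assms by (rule not_in_VD)
  show c: "cos \<theta> \<noteq> 0" using assms V by auto
  have sec2: "(inverse (cos \<theta>))\<^sup>2 \<in> M"
    using mult_M[OF M_subset[OF sec] sec] by (simp add: power2_eq_square)
  have t: "(tan \<theta>)\<^sup>2 = (inverse (cos \<theta>))\<^sup>2 - 1"
    using tan_sec[OF c] by simp
  show tV: "tan \<theta> \<in> V"
    by (rule power2_V) (simp only: t V(3)[OF M_subset[OF sec2] V(1)])
  have "(tan \<theta> - 1)\<^sup>2 = (inverse (cos \<theta>))\<^sup>2 - tan \<theta> * 2"
    using t by (simp add: power2_diff)
  also have "\<dots> \<in> M" using sec2 mult_M[OF tV two_in_M] by (rule diff_M)
  finally show "tan \<theta> - 1 \<in> M" by (rule power2_M)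
qed

text \<open>Up to a scalar, \<open>rot_z \<theta>\<close> reduces to the projection onto \<open>(1, 1, 0)\<close> and \<open>rot_x \<theta>\<close> to the
  one onto \<open>(0, 1, 1)\<close> modulo \<open>M\<close> unless \<open>cos \<theta> = 0\<close>; these two vectors are not orthogonal
  modulo \<open>M\<close>, which is what keeps the denominators of a product from cancelling.\<close>

definition in_span110 :: "real^3 \<Rightarrow> bool" where
  "in_span110 v \<longleftrightarrow> (\<exists>l\<in>M. l * v $ 1 - 1 \<in> M \<and> l * v $ 2 - 1 \<in> M \<and> l * v $ 3 \<in> M)"

text \<open>The sum of the first two coordinates is the inner product with (1, 1, 0): a multiple of
  \<open>v\<close> is integral and not orthogonal to that vector modulo \<open>M\<close>. With
  \<open>L\<close> = \<open>M\<close> the vector \<open>v\<close> itself has denominators;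
  \<open>L\<close> = \<open>V\<close> also admits an integral starting vector.\<close>

definition meets110 :: "real set \<Rightarrow> real^3 \<Rightarrow> bool" where
  "meets110 L v \<longleftrightarrow> (\<exists>l\<in>L. l * v $ 1 \<in> V \<and> l * v $ 2 \<in> V \<and> l * v $ 3 \<in> V \<and> l * (v $ 1 + v $ 2) - 1 \<in> M)"

lemma diff_one_M_imp_V: "x - 1 \<in> M \<Longrightarrow> x \<in> V"
  using V(6)[OF M_subset V(1), of "x - 1"] by simp

lemma rot_x_nth:
  "(rot_x \<theta> *v v) $ 1 = v $ 1" "(rot_x \<theta> *v v) $ 2 = cos \<theta> * v $ 2 - sin \<theta> * v $ 3"
  "(rot_x \<theta> *v v) $ 3 = sin \<theta> * v $ 2 + cos \<theta> * v $ 3"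
  by (simp_all add: rot_x_def matrix_vector_mult_def sum_3)

lemma rot_z_nth:
  "(rot_z \<theta> *v v) $ 1 = cos \<theta> * v $ 1 - sin \<theta> * v $ 2" "(rot_z \<theta> *v v) $ 2 = sin \<theta> * v $ 1 + cos \<theta> * v $ 2"
  "(rot_z \<theta> *v v) $ 3 = v $ 3"
  by (simp_all add: rot_z_def matrix_vector_mult_def sum_3)

text \<open>Divided by its cosine, the rotation sends (x, y, z) to (x - y, x + y, 0) modulo
  \<open>M\<close>, and x - y agrees with x + y because 2 is in \<open>M\<close>. The factor 1/cos
  moves the scalar from \<open>V\<close> into \<open>M\<close>.\<close>

lemma in_span110_rot_z:
  assumes "cos \<theta> \<notin> V" "meets110 V v"
  shows "in_span110 (rot_z \<theta> *v v)"
proof -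
  note t = tan_cong_one[OF assms(1)]
  obtain l where l: "l \<in> V" "l * v $ 1 \<in> V" "l * v $ 2 \<in> V" "l * v $ 3 \<in> V" "l * (v $ 1 + v $ 2) - 1 \<in> M"
    using assms(2) by (auto simp: meets110_def)
  have s: "sin \<theta> = tan \<theta> * cos \<theta>" using t(2) by (simp add: tan_def)
  let ?l = "l * inverse (cos \<theta>)"
  have eqs: "?l * (rot_z \<theta> *v v) $ 1 - 1
      = (l * (v $ 1 + v $ 2) - 1) - (l * v $ 2) * (tan \<theta> - 1) - (l * v $ 2) * 2"
    "?l * (rot_z \<theta> *v v) $ 2 - 1 = (l * (v $ 1 + v $ 2) - 1) + (l * v $ 1) * (tan \<theta> - 1)"
    "?l * (rot_z \<theta> *v v) $ 3 = (l * v $ 3) * inverse (cos \<theta>)"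
    using t(2) by (simp_all add: rot_z_nth s field_simps)
  show ?thesis
    unfolding in_span110_def
  proof (intro bexI[of _ ?l] conjI)
    show "?l * (rot_z \<theta> *v v) $ 1 - 1 \<in> M"
      unfolding eqs by (intro diff_M[OF diff_M] mult_M l t two_in_M)
    show "?l * (rot_z \<theta> *v v) $ 2 - 1 \<in> M"
      unfolding eqs by (intro add_M mult_M l t)
    show "?l * (rot_z \<theta> *v v) $ 3 \<in> M"
      unfolding eqs by (intro mult_M l t)
    show "?l \<in> M" using l(1) t(1) by (rule mult_M)
  qed
qed

text \<open>From a multiple of \<open>v\<close> that is (1, 1, 0) modulo \<open>M\<close>, a quarter
  turn leads to (1, 0, z) with z = 1 or z = -1, and any other rotation allowed here, divided by its
  cosine, to (0, 1, 1). Both have inner product 1 with (1, 1, 0).\<close>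

lemma meets110_rot_x:
  assumes "cos \<theta> \<notin> V \<or> cos \<theta> = 0" "in_span110 v"
  shows "meets110 M (rot_x \<theta> *v v)"
proof -
  obtain l where l: "l \<in> M" "l * v $ 1 - 1 \<in> M" "l * v $ 2 - 1 \<in> M" "l * v $ 3 \<in> M"
    using assms(2) by (auto simp: in_span110_def)
  note lV = diff_one_M_imp_V[OF l(2)] diff_one_M_imp_V[OF l(3)] M_subset[OF l(4)]
  show ?thesis
  proof (cases "cos \<theta> = 0")
    case True
    then have s: "sin \<theta> \<in> V" using sin_zero_abs_cos_one[of \<theta>] sin_cos_squared_add[of \<theta>] V(1) V(5)[OF V(1)]
      by (auto simp: power2_eq_1_iff)
    have eqs: "l * ((rot_x \<theta> *v v) $ 1 + (rot_x \<theta> *v v) $ 2) - 1 = (l * v $ 1 - 1) - sin \<theta> * (l * v $ 3)"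
      "l * (rot_x \<theta> *v v) $ 2 = - (sin \<theta> * (l * v $ 3))"
      "l * (rot_x \<theta> *v v) $ 3 = sin \<theta> * (l * v $ 2)"
      by (simp_all add: rot_x_nth True algebra_simps)
    show ?thesis
      unfolding meets110_def
    proof (intro bexI[of _ l] conjI)
      show "l * (rot_x \<theta> *v v) $ 1 \<in> V" using lV by (simp add: rot_x_nth)
      show "l * (rot_x \<theta> *v v) $ 2 \<in> V" unfolding eqs by (intro V(4,5) s lV)
      show "l * (rot_x \<theta> *v v) $ 3 \<in> V" unfolding eqs by (intro V(4,5) s lV)
      show "l * ((rot_x \<theta> *v v) $ 1 + (rot_x \<theta> *v v) $ 2) - 1 \<in> M"
        unfolding eqs by (intro diff_M mult_M l s)
    qed (rule l(1))
  next
    case False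
    then have c: "cos \<theta> \<notin> V" using assms(1) by simp
    note t = tan_cong_one[OF c]
    have s: "sin \<theta> = tan \<theta> * cos \<theta>" using t(2) by (simp add: tan_def)
    let ?l = "l * inverse (cos \<theta>)"
    have eqs: "?l * (rot_x \<theta> *v v) $ 1 = (l * v $ 1) * inverse (cos \<theta>)"
      "?l * (rot_x \<theta> *v v) $ 2 = l * v $ 2 - tan \<theta> * (l * v $ 3)"
      "?l * (rot_x \<theta> *v v) $ 3 = tan \<theta> * (l * v $ 2) + l * v $ 3"
      "?l * ((rot_x \<theta> *v v) $ 1 + (rot_x \<theta> *v v) $ 2) - 1
        = (l * v $ 1) * inverse (cos \<theta>) + (l * v $ 2 - 1) - tan \<theta> * (l * v $ 3)"
      using t(2) by (simp_all add: rot_x_nth s field_simps)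
    show ?thesis
      unfolding meets110_def
    proof (intro bexI[of _ ?l] conjI)
      show "?l * (rot_x \<theta> *v v) $ 1 \<in> V" "?l * (rot_x \<theta> *v v) $ 2 \<in> V" "?l * (rot_x \<theta> *v v) $ 3 \<in> V"
        unfolding eqs by (intro V(3,4,6) M_subset[OF t(1)] t lV)+
      show "?l * ((rot_x \<theta> *v v) $ 1 + (rot_x \<theta> *v v) $ 2) - 1 \<in> M"
        unfolding eqs by (intro diff_M[OF add_M] mult_M l t lV)
      show "?l \<in> M" using M_subset[OF l(1)] t(1) by (rule mult_M)
    qed
  qed
qed

lemma meets110_mono: "meets110 M v \<Longrightarrow> meets110 V v"
  using M_subset by (auto simp: meets110_def)

text \<open>For integral coordinates the scalar \<open>l\<close> from \<open>M\<close> would force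
  \<open>l * v $ 1\<close> or \<open>l * (v $ 1 + v $ 2)\<close> into the ideal \<open>M\<close>,
  although it is 1 modulo \<open>M\<close>.\<close>

lemma not_integral:
  assumes "in_span110 v \<or> meets110 M v"
  shows "v $ 1 \<notin> V \<or> v $ 2 \<notin> V"
proof (rule ccontr)
  assume v: "\<not> (v $ 1 \<notin> V \<or> v $ 2 \<notin> V)"
  have "x \<notin> V" if "l \<in> M" "l * x - 1 \<in> M" for l x
  proof
    assume "x \<in> V"
    then have "x * l - (l * x - 1) \<in> M" using diff_M[OF mult_M that(2)] that(1) by blast
    then show False using one_notin_M by (simp add: mult.commute)
  qed
  then show False using assms v V(6) unfolding in_span110_def meets110_def by blast
qed

lemma meets110_axis: "meets110 V (axis 1 1)"
  using V(1,2) one_notin_M by (auto simp: meets110_def axis_def M_def intro!: bexI[of _ 1])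

end

section \<open>Normal forms and presentations\<close>

lemma (in group) int_pow_intertwine:
  assumes [simp]: "x \<in> carrier G" "y \<in> carrier G" "u \<in> carrier G" and eq: "x \<otimes> u = u \<otimes> y"
  shows "x [^] (k :: int) \<otimes> u = u \<otimes> y [^] k"
proof -
  have nat: "x [^] n \<otimes> u = u \<otimes> y [^] n" for n :: nat
  proof (induction n)
    case (Suc n)
    have "x [^] Suc n \<otimes> u = x [^] n \<otimes> u \<otimes> y" using eq by (simp add: m_assoc)
    also have "\<dots> = u \<otimes> y [^] Suc n" by (simp add: Suc m_assoc)
    finally show ?case .
  qed simp
  show ?thesis
  proof (cases k rule: int_cases2)
    case (nonneg n)
    then show ?thesis using nat by (simp add: int_pow_int)
  next
    case (nonpos n)
    have "inv (x [^] n) \<otimes> u = u \<otimes> inv (y [^] n)" for n :: nat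
    proof -
      have "inv (x [^] n) \<otimes> u = inv (x [^] n) \<otimes> (u \<otimes> y [^] n) \<otimes> inv (y [^] n)" by (simp add: m_assoc)
      also have "\<dots> = u \<otimes> inv (y [^] n)" unfolding nat[symmetric] by (simp add: m_assoc[symmetric])
      finally show ?thesis .
    qed
    then show ?thesis using nonpos by (simp add: int_pow_neg_int)
  qed
qed

text \<open>The four elements may coincide. In the application \<open>c\<close> or \<open>d\<close>
  is trivial when the corresponding rotation has odd order, so one lemma serves all three
  presentations.\<close>

lemma (in group) subgroup_klein_four:
  assumes [simp]: "c \<in> carrier G" "d \<in> carrier G" and "c \<otimes> c = \<one>" "d \<otimes> d = \<one>" "d \<otimes> c = c \<otimes> d"
  shows "subgroup {\<one>, c, d, c \<otimes> d} G"
proof -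
  have inv: "inv c = c" "inv d = d" using assms by (auto intro: inv_equality)
  have *: "c \<otimes> (c \<otimes> z) = z" "d \<otimes> (d \<otimes> z) = z" "d \<otimes> (c \<otimes> z) = c \<otimes> (d \<otimes> z)"
    if "z \<in> carrier G" for z
    using that assms by (simp_all add: m_assoc[symmetric])
  show ?thesis
    by (rule subgroupI) (auto simp: assms * inv m_assoc inv_mult_group)
qed

text \<open>\<open>U\<close> stands for the subgroup of half turns, and \<open>n s\<close> is an
  exponent that takes \<open>g s\<close> into \<open>U\<close>. Indexing the generators by
  \<open>bool\<close> makes \<open>\<not> s\<close> the other generator.\<close>

locale two_generator_group = group H for H (structure) +
  fixes g :: "bool \<Rightarrow> 'a" and n :: "bool \<Rightarrow> int" and U :: "'a set"
  assumes gen_closed [simp]: "g s \<in> carrier H"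
    and generated: "carrier H = generate H (range g)"
    and subgroup_U: "subgroup U H"
    and pow_in_U: "g s [^] n s \<in> U"
    and gen_comm: "u \<in> U \<Longrightarrow> g s \<otimes> u = u \<otimes> g s \<or> g s \<otimes> u = u \<otimes> inv (g s)"
begin

text \<open>\<open>reduced s w\<close> says that \<open>w\<close> is an alternating product of nontrivial powers (modulo \<open>U\<close>)
  of the two generators which does not begin with a power of \<open>g s\<close>.\<close>

inductive reduced :: "bool \<Rightarrow> 'a \<Rightarrow> bool" where
  one: "reduced s \<one>"
| step: "\<not> n s dvd i \<Longrightarrow> reduced s w \<Longrightarrow> reduced (\<not> s) (g s [^] i \<otimes> w)"

lemma reduced_closed [simp]: "reduced s w \<Longrightarrow> w \<in> carrier H"
  by (induction rule: reduced.induct) auto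

text \<open>The exponent 0 is allowed, so that a leading power of \<open>g t\<close> can be split
  off whether or not the word has one.\<close>

lemma reduced_split:
  assumes "reduced s w"
  obtains i v where "w = g t [^] (i :: int) \<otimes> v" "reduced t v"
proof (cases "s = t")
  case True
  then show ?thesis using assms that[of 0 w] by simp
next
  case False
  from assms show ?thesis
  proof cases
    case one
    then show ?thesis using that[of 0 \<one>] reduced.one by simp
  next
    case (step s' i v)
    then show ?thesis using that[of i v] False by (cases t; cases s') auto
  qed
qed

definition normal_forms :: "'a set" where
  "normal_forms = {u \<otimes> w | u s w. u \<in> U \<and> reduced s w}"

lemma normal_formsI: "u \<in> U \<Longrightarrow> reduced s w \<Longrightarrow> u \<otimes> w \<in> normal_forms"
  by (auto simp: normal_forms_def)

lemma U_closed [simp]: "u \<in> U \<Longrightarrow> u \<in> carrier H"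
  using subgroup.subset[OF subgroup_U] by blast

text \<open>The power moves past \<open>u\<close> with a possible change of sign of the exponent and
  merges with the leading power of the same generator. If the merged exponent is divisible by
  \<open>n t\<close>, the power is in \<open>U\<close> and is absorbed on the left; otherwise the
  word stays alternating.\<close>

lemma pow_mult_normal_forms:
  assumes "x \<in> normal_forms"
  shows "g t [^] (k :: int) \<otimes> x \<in> normal_forms"
proof -
  obtain u s w where x: "x = u \<otimes> w" "u \<in> U" "reduced s w"
    using assms by (auto simp: normal_forms_def)
  obtain j :: int where j: "g t [^] k \<otimes> u = u \<otimes> g t [^] j"
  proof (cases "g t \<otimes> u = u \<otimes> g t")
    case True
    then show ?thesis using that[of k] int_pow_intertwine[OF _ _ _ True] x(2) by simp
  next
    case False
    then have "g t \<otimes> u = u \<otimes> inv (g t)" using gen_comm[OF x(2)] by blast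
    then have "g t [^] k \<otimes> u = u \<otimes> inv (g t) [^] k"
      using x(2) by (intro int_pow_intertwine) auto
    also have "inv (g t) [^] k = g t [^] (- k)" by (simp add: int_pow_neg int_pow_inv)
    finally show ?thesis by (rule that)
  qed
  obtain i v where w: "w = g t [^] (i :: int) \<otimes> v" "reduced t v"
    by (rule reduced_split[OF x(3)])
  have "g t [^] k \<otimes> x = g t [^] k \<otimes> u \<otimes> w" using x by (simp add: m_assoc)
  also have "\<dots> = u \<otimes> (g t [^] (j + i) \<otimes> v)" using x w by (simp add: j m_assoc int_pow_mult)
  finally have eq: "g t [^] k \<otimes> x = u \<otimes> (g t [^] (j + i) \<otimes> v)" .
  show ?thesis
  proof (cases "n t dvd j + i")
    case True
    then obtain l where "j + i = n t * l" by blast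
    then have "g t [^] (j + i) = (g t [^] n t) [^] l" by (simp add: int_pow_pow)
    then have "g t [^] (j + i) \<in> U"
      using subgroup_int_pow_closed[OF subgroup_U pow_in_U, of t l] by simp
    then have "u \<otimes> g t [^] (j + i) \<in> U" using subgroup.m_closed[OF subgroup_U x(2)] by simp
    then have "u \<otimes> g t [^] (j + i) \<otimes> v \<in> normal_forms" using w(2) by (rule normal_formsI)
    then show ?thesis using eq x w by (simp add: m_assoc)
  next
    case False
    then show ?thesis unfolding eq using normal_formsI[OF x(2) reduced.step[OF False w(2)]] by simp
  qed
qed

lemma normal_form:
  assumes "x \<in> carrier H"
  obtains u s w where "u \<in> U" "reduced s w" "x = u \<otimes> w"
proof -
  have nf_closed: "y \<in> normal_forms \<Longrightarrow> y \<in> carrier H" for y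
    by (auto simp: normal_forms_def)
  have "x \<in> generate H (range g)" using assms generated by simp
  \<comment> \<open>Stability under left multiplication, unlike mere membership, composes in the
    product case of the induction; applied to the identity it gives membership.\<close>
  then have "\<forall>y\<in>normal_forms. x \<otimes> y \<in> normal_forms"
  proof induction
    case one
    then show ?case using nf_closed by auto
  next
    case (incl h)
    then obtain s where "h = g s" by blast
    then show ?case using pow_mult_normal_forms[of _ s 1] by simp
  next
    case (inv h)
    then obtain s where "h = g s" by blast
    then show ?case using pow_mult_normal_forms[of _ s "- 1"] by (simp add: int_pow_neg)
  next
    case (eng h1 h2)
    have "h1 \<in> carrier H" "h2 \<in> carrier H" using eng.hyps generated by auto
    then show ?case using eng.IH nf_closed by (auto simp: m_assoc)
  qed
  moreover have "\<one> \<in> normal_forms"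
    using normal_formsI[OF subgroup.one_closed[OF subgroup_U] reduced.one] by simp
  ultimately have "x \<otimes> \<one> \<in> normal_forms" by (rule bspec)
  then have "x \<in> normal_forms" using assms by simp
  then show ?thesis using that unfolding normal_forms_def by blast
qed

end

section \<open>Evaluation of words and homomorphisms out of presented groups\<close>

definition word_eval :: "('g, 'm) monoid_scheme \<Rightarrow> ('a \<Rightarrow> 'g) \<Rightarrow> 'a word \<Rightarrow> 'g" where
  "word_eval K f w = foldr (\<lambda>(x, b) z. (if b then f x else inv\<^bsub>K\<^esub> f x) \<otimes>\<^bsub>K\<^esub> z) w \<one>\<^bsub>K\<^esub>"

context group
begin

lemma word_eval_Nil [simp]: "word_eval G f [] = \<one>"
  and word_eval_Cons [simp]: "word_eval G f ((x, b) # w) = (if b then f x else inv f x) \<otimes> word_eval G f w"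
  by (simp_all add: word_eval_def)

lemma word_eval_closed [simp]:
  "f \<in> S \<rightarrow> carrier G \<Longrightarrow> w \<in> words S \<Longrightarrow> word_eval G f w \<in> carrier G"
  by (induction w) (auto simp: words_def Pi_iff intro!: m_closed)

lemma word_eval_append:
  "f \<in> S \<rightarrow> carrier G \<Longrightarrow> v \<in> words S \<Longrightarrow> w \<in> words S \<Longrightarrow>
    word_eval G f (v @ w) = word_eval G f v \<otimes> word_eval G f w"
proof (induction v)
  case (Cons l v)
  obtain x b where "l = (x, b)" by force
  moreover have "x \<in> S" "v \<in> words S" using Cons.prems calculation by (auto simp: words_def)
  moreover have "f x \<in> carrier G" using Cons.prems calculation by auto
  ultimately show ?case using Cons by (simp add: m_assoc)
qed simp

lemma word_eval_gen_pow:
  "f x \<in> carrier G \<Longrightarrow> word_eval G f (gen_pow x n) = f x [^] n"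
proof (induction n)
  case (Suc n)
  then show ?case using nat_pow_Suc2[of "f x" n] by (simp add: gen_pow_def)
qed (simp add: gen_pow_def)

lemma word_eval_cong_word_equiv:
  assumes "(v, w) \<in> word_equiv S R" and f: "f \<in> S \<rightarrow> carrier G"
    and R: "\<And>r. r \<in> R \<Longrightarrow> word_eval G f r = \<one>"
  shows "word_eval G f v = word_eval G f w"
  using assms(1)
proof induction
  case (cancel u v x b)
  have fx: "f x \<in> carrier G" using f cancel by auto
  have xs: "[(x, b), (x, \<not> b)] \<in> words S" using cancel by (auto simp: words_def)
  have "[(x, b), (x, \<not> b)] @ v \<in> words S" using cancel by (auto simp: words_def)
  moreover have "word_eval G f [(x, b), (x, \<not> b)] = \<one>" using fx by auto
  ultimately show ?case
    using cancel f xs by (simp add: word_eval_append[OF f] del: append_Cons append_Nil word_eval_Cons)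
next
  case (relator u v r)
  have "r @ v \<in> words S" using relator by (auto simp: words_def)
  then show ?case using relator f R by (simp add: word_eval_append[OF f])
qed auto

text \<open>Von Dyck's theorem: evaluation respects \<open>word_equiv\<close> as soon as the
  relators evaluate to the identity, so any representative of a class may be used.\<close>

lemma presented_group_hom:
  fixes S :: "'c set"
  assumes f: "f \<in> S \<rightarrow> carrier G" and R: "\<And>r. r \<in> R \<Longrightarrow> word_eval G f r = \<one>"
  obtains h where "h \<in> hom (presented_group S R) G"
    "\<And>w. w \<in> words S \<Longrightarrow> h (word_class S R w) = word_eval G f w"
proof -
  define h where "h X = word_eval G f (SOME w. w \<in> X)" for X
  have h: "h (word_class S R w) = word_eval G f w" if "w \<in> words S" for w
  proof -
    have "w \<in> word_class S R w" unfolding word_class_def using that word_equiv.refl by blast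
    then have "(SOME v. v \<in> word_class S R w) \<in> word_class S R w" by (rule someI)
    then show ?thesis
      unfolding h_def using word_eval_cong_word_equiv[OF _ f R] by (fastforce simp: word_class_def)
  qed
  have app: "v @ w \<in> words S" if "v \<in> words S" "w \<in> words S" for v w :: "'c word"
    using that by (auto simp: words_def)
  have "h \<in> hom (presented_group S R) G"
    by (rule homI) (auto simp: carrier_presented_group mult_word_class h f app word_eval_append[OF f] word_eval_closed[OF f])
  then show ?thesis using h that by blast
qed

end

lemma word_class_relator:
  assumes "r \<in> R" "r \<in> words S"
  shows "word_class S R r = \<one>\<^bsub>presented_group S R\<^esub>"
proof -
  have "([] @ r @ [], [] @ []) \<in> word_equiv S R"
    using assms by (intro word_equiv.relator) (auto simp: words_def)
  then show ?thesis
    unfolding one_presented_group word_class_def using equiv_class_eq[OF equiv_word_equiv] by fastforce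
qed

text \<open>This turns relators, which are words, into equations between the generators of the
  presented group.\<close>

lemma word_class_eq_word_eval:
  assumes "w \<in> words S"
  shows "word_class S R w = word_eval (presented_group S R) (\<lambda>x. word_class S R [(x, True)]) w"
  using assms
proof (induction w)
  case Nil
  then show ?case by (simp add: word_eval_def one_presented_group)
next
  case (Cons l w)
  interpret group "presented_group S R" by (rule group_presented_group)
  obtain x b where l: "l = (x, b)" by force
  have x: "x \<in> S" and w: "w \<in> words S" using Cons.prems l by (auto simp: words_def)
  have xs: "[(x, b)] \<in> words S" for b using x by (auto simp: words_def)
  have "word_class S R [(x, False)] \<otimes>\<^bsub>presented_group S R\<^esub> word_class S R [(x, True)]
      = word_class S R ([] @ [(x, False), (x, \<not> False)] @ [])"
    using xs by (simp add: mult_word_class)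
  also have "\<dots> = word_class S R ([] @ [])"
    unfolding word_class_def by (intro equiv_class_eq[OF equiv_word_equiv] word_equiv.cancel x) (auto simp: words_def)
  finally have "inv\<^bsub>presented_group S R\<^esub> word_class S R [(x, True)] = word_class S R [(x, False)]"
    using xs by (intro inv_equality) (auto simp: one_presented_group carrier_presented_group)
  then have "word_class S R [(x, b)] = (if b then word_class S R [(x, True)] else inv\<^bsub>presented_group S R\<^esub> word_class S R [(x, True)])"
    by auto
  moreover have "word_class S R (l # w) = word_class S R [(x, b)] \<otimes>\<^bsub>presented_group S R\<^esub> word_class S R w"
    using xs w l by (simp add: mult_word_class)
  ultimately show ?case using Cons.IH[OF w] l by simp
qed

lemma presented_group_generated:
  "carrier (presented_group S R) = generate (presented_group S R) ((\<lambda>x. word_class S R [(x, True)]) ` S)"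
    (is "carrier ?P = generate ?P (?c ` S)")
proof
  interpret group ?P by (rule group_presented_group)
  have sub: "?c ` S \<subseteq> carrier ?P"
    by (auto simp: carrier_presented_group words_def)
  have "word_eval ?P ?c w \<in> generate ?P (?c ` S)" if "w \<in> words S" for w
    using that
  proof (induction w)
    case (Cons l w)
    obtain x b where l: "l = (x, b)" by force
    then have "x \<in> S" "w \<in> words S" using Cons.prems by (auto simp: words_def)
    then show ?case
      using Cons.IH l by (auto intro!: generate.eng intro: generate.incl generate.inv)
  qed (simp add: generate.one)
  then show "carrier ?P \<subseteq> generate ?P (?c ` S)"
    unfolding carrier_presented_group using word_class_eq_word_eval[of _ S R] by (intro image_subsetI) metis
  show "generate ?P (?c ` S) \<subseteq> carrier ?P"
    using generate_incl[OF sub] .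
qed

section \<open>Faithfulness of the rotation representation\<close>

lemma SO3_simps: "carrier SO3 = {Q. rotation_matrix Q}" "x \<otimes>\<^bsub>SO3\<^esub> y = x ** y" "\<one>\<^bsub>SO3\<^esub> = mat 1"
  by (simp_all add: SO3_def)

lemma rot_zero: "rot_x 0 = mat 1" "rot_z 0 = mat 1"
  by (simp_all add: rot_x_def rot_z_def vec_eq_iff forall_3 mat_def)

lemma rot_add: "rot_x s ** rot_x t = rot_x (s + t)" "rot_z s ** rot_z t = rot_z (s + t)"
  by (simp_all add: rot_x_def rot_z_def vec_eq_iff forall_3 matrix_matrix_mult_def sum_3 cos_add sin_add)

lemma rot_int_pow:
  "rot_x t [^]\<^bsub>SO3\<^esub> (k :: int) = rot_x (of_int k * t)" "rot_z t [^]\<^bsub>SO3\<^esub> (k :: int) = rot_z (of_int k * t)"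
proof -
  interpret group SO3 by (rule group_SO3)
  have *: "r t [^]\<^bsub>SO3\<^esub> k = r (of_int k * t)"
    if r: "\<And>s. r s \<in> carrier SO3" "r 0 = mat 1" "\<And>s t. r s ** r t = r (s + t)" for r
  proof -
    have nat: "r t [^]\<^bsub>SO3\<^esub> n = r (real n * t)" for n :: nat
      by (induction n) (simp_all add: SO3_simps r algebra_simps)
    have inv: "inv\<^bsub>SO3\<^esub> r s = r (- s)" for s
      using r by (intro inv_equality) (auto simp: SO3_simps)
    show ?thesis
      by (cases k rule: int_cases2) (simp_all add: int_pow_int int_pow_neg_int nat inv r)
  qed
  show "rot_x t [^]\<^bsub>SO3\<^esub> k = rot_x (of_int k * t)" "rot_z t [^]\<^bsub>SO3\<^esub> k = rot_z (of_int k * t)"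
    by (intro *; simp add: rot_in_SO3 rot_zero rot_add)+
qed

lemma rot_nat_pow:
  "rot_x t [^]\<^bsub>SO3\<^esub> (k :: nat) = rot_x (real k * t)" "rot_z t [^]\<^bsub>SO3\<^esub> (k :: nat) = rot_z (real k * t)"
  using rot_int_pow[of t "int k"] by (simp_all add: int_pow_int)

lemma rot_x_rot_z_nth:
  "(rot_x t ** rot_z r) $ 1 $ 1 = cos r" "(rot_x t ** rot_z r) $ 2 $ 1 = cos t * sin r"
  "(rot_x t ** rot_z r) $ 2 $ 2 = cos t * cos r" "(rot_x t ** rot_z r) $ 3 $ 2 = sin t * cos r"
  by (simp_all add: rot_x_def rot_z_def matrix_matrix_mult_def sum_3)

lemma matrix_vector_mult_axis_nth: "((Q :: real^3^3) *v axis 1 1) $ i = Q $ i $ 1"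
  by (simp add: matrix_vector_mult_def axis_def sum_3)

lemma (in group) commute_past_product:
  assumes "x \<in> carrier G" "y \<in> carrier G" "z \<in> carrier G" "c \<in> carrier G" "d \<in> carrier G"
    and "x \<otimes> c = c \<otimes> y" "y \<otimes> d = d \<otimes> z"
  shows "x \<otimes> (c \<otimes> d) = (c \<otimes> d) \<otimes> z"
proof -
  have "x \<otimes> (c \<otimes> d) = (x \<otimes> c) \<otimes> d" using assms(1-5) by (simp add: m_assoc)
  also have "\<dots> = c \<otimes> (y \<otimes> d)" unfolding assms(6) using assms(1-5) by (simp add: m_assoc)
  also have "\<dots> = (c \<otimes> d) \<otimes> z" unfolding assms(7) using assms(1-5) by (simp add: m_assoc)
  finally show ?thesis .
qed

text \<open>A zero of the sine means that \<open>p\<close> divides 2i. For odd p = m the factor 2 is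
  cancelled by coprimality, for p = 2m it cancels directly.\<close>

lemma sin_multiple_nonzero:
  assumes "p > 0" "p = m \<and> odd m \<or> p = 2 * m" "\<not> int m dvd i"
  shows "sin (of_int i * (2 * pi / real p)) \<noteq> 0"
proof
  assume "sin (of_int i * (2 * pi / real p)) = 0"
  then obtain j :: int where "of_int i * (2 * pi / real p) = of_int j * pi"
    by (auto simp: sin_zero_iff_int2)
  then have "(of_int (2 * i) :: real) = of_int (j * int p)"
    using assms(1) by (simp add: field_simps)
  then have "2 * i = j * int p" by (simp only: of_int_eq_iff)
  then have "int m dvd 2 * i \<and> odd m \<or> i = j * int m"
    using assms(2) by auto
  then show False
    using assms(3) coprime_dvd_mult_right_iff[of "int m" 2 i] by auto
qed

lemma sin_double_multiple_nonzero:
  assumes "q > 0" "q = n \<or> q = 2 * n" "odd n" "\<not> int n dvd i"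
  shows "sin (2 * (of_int i * (2 * pi / real q))) \<noteq> 0"
proof -
  have "coprime (int n) 2" using assms(3) by simp
  then have "\<not> int n dvd 2 * i" using assms(4) coprime_dvd_mult_right_iff by blast
  then have "sin (of_int (2 * i) * (2 * pi / real q)) \<noteq> 0"
    using assms(1-3) by (intro sin_multiple_nonzero[of q n]) auto
  then show ?thesis by (simp add: mult.assoc)
qed

text \<open>A kernel element is u * w with \<open>u\<close> a product of half turns and
  \<open>w\<close> reduced; the valuation forces w = 1 or a power of \<open>a\<close>, and entries
  of the matrices settle the rest. The group \<open>H\<close> is arbitrary so that the lemma serves
  both the presentations on two letters and the free product. The exponents \<open>m\<close> and
  \<open>n\<close> are \<open>p\<close> and \<open>q\<close>, or half of them if there is a half
  turn that inverts the other generator.\<close>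

lemma rotation_hom_injective:
  fixes H (structure) and p q m n :: nat
  assumes "group H" and h: "h \<in> hom H SO3"
    and ab [simp]: "a \<in> carrier H" "b \<in> carrier H" and gen: "carrier H = generate H {a, b}"
    and ha: "h a = rot_x (2 * pi / real p)" and hb: "h b = rot_z (2 * pi / real q)"
    and pos: "p > 0" "q > 0" and n: "odd n"
    and m_rel: "p = m \<and> odd m \<and> a [^] m = \<one> \<or>
      p = 2 * m \<and> a [^] m \<otimes> a [^] m = \<one> \<and> b \<otimes> a [^] m = a [^] m \<otimes> inv b"
    and n_rel: "q = n \<and> b [^] n = \<one> \<or>
      q = 2 * n \<and> b [^] n \<otimes> b [^] n = \<one> \<and> a \<otimes> b [^] n = b [^] n \<otimes> inv a"
  shows "inj_on h (carrier H)"
proof -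
  interpret group H by fact
  interpret SO3: group SO3 by (rule group_SO3)
  interpret h: group_hom H SO3 h using h by unfold_locales
  define c d where "c = a [^] m" and "d = b [^] n"
  have cd [simp]: "c \<in> carrier H" "d \<in> carrier H" by (simp_all add: c_def d_def)
  have cc: "c \<otimes> c = \<one>" and dd: "d \<otimes> d = \<one>"
    using m_rel n_rel by (auto simp: c_def d_def)
  have ac: "a \<otimes> c = c \<otimes> a" and bd: "b \<otimes> d = d \<otimes> b"
    unfolding c_def d_def by (metis ab nat_pow_Suc nat_pow_Suc2)+
  have ad: "a \<otimes> d = d \<otimes> a \<or> a \<otimes> d = d \<otimes> inv a"
    using n_rel unfolding d_def by auto
  have bc: "b \<otimes> c = c \<otimes> b \<or> b \<otimes> c = c \<otimes> inv b"
    using m_rel unfolding c_def by auto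
  have bd': "inv b \<otimes> d = d \<otimes> inv b"
    using int_pow_intertwine[OF _ _ _ bd, of "- 1"] by (simp add: int_pow_neg)
  have "inv c = c" using cc by (intro inv_equality) auto
  \<comment> \<open>As \<open>c\<close> is its own inverse, replacing \<open>a\<close> by its
    inverse does not change the m-th power; so both alternatives of \<open>ad\<close> make
    \<open>c\<close> and \<open>d\<close> commute.\<close>
  then have ic: "inv a [^] int m = c" by (simp add: nat_pow_inv int_pow_int c_def)
  have dc: "d \<otimes> c = c \<otimes> d"
    using ad
  proof
    assume "a \<otimes> d = d \<otimes> a"
    from int_pow_intertwine[OF _ _ _ this, of "int m"] show ?thesis
      by (simp add: int_pow_int c_def)
  next
    assume "a \<otimes> d = d \<otimes> inv a"
    from int_pow_intertwine[OF _ _ _ this, of "int m"] show ?thesis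
      by (simp add: ic) (simp add: int_pow_int c_def)
  qed
  interpret two_generator_group H "\<lambda>s. if s then a else b" "\<lambda>s. if s then int m else int n" "{\<one>, c, d, c \<otimes> d}"
  proof (intro two_generator_group.intro two_generator_group_axioms.intro)
    show "group H" by (rule is_group)
    have "range (\<lambda>s. if s then a else b) = {a, b}" by (auto simp: UNIV_bool)
    then show "carrier H = generate H (range (\<lambda>s. if s then a else b))" using gen by simp
    show "subgroup {\<one>, c, d, c \<otimes> d} H" by (rule subgroup_klein_four) (simp_all add: cc dd dc)
    show "(if s then a else b) [^] (if s then int m else int n) \<in> {\<one>, c, d, c \<otimes> d}" for s
      by (cases s) (simp_all add: int_pow_int c_def d_def)
    show "(if s then a else b) \<otimes> u = u \<otimes> (if s then a else b) \<or>
        (if s then a else b) \<otimes> u = u \<otimes> inv (if s then a else b)" if "u \<in> {\<one>, c, d, c \<otimes> d}" for s u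
    proof (cases s)
      case True
      have "a \<otimes> (c \<otimes> d) = (c \<otimes> d) \<otimes> a \<or> a \<otimes> (c \<otimes> d) = (c \<otimes> d) \<otimes> inv a"
        using ad commute_past_product[OF _ _ _ _ _ ac] by auto
      then show ?thesis using True that ac ad by auto
    next
      case False
      have "b \<otimes> (c \<otimes> d) = (c \<otimes> d) \<otimes> b \<or> b \<otimes> (c \<otimes> d) = (c \<otimes> d) \<otimes> inv b"
        using bc commute_past_product[OF _ _ _ _ _ _ bd] commute_past_product[OF _ _ _ _ _ _ bd'] by auto
      then show ?thesis using False that bc bd by auto
    qed
  qed auto

  define \<theta> \<phi> where "\<theta> i = of_int i * (2 * pi / real p)" and "\<phi> i = of_int i * (2 * pi / real q)" for i
  have hai: "h (a [^] i) = rot_x (\<theta> i)" and hbi: "h (b [^] i) = rot_z (\<phi> i)" for i :: int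
    by (simp_all add: h.hom_int_pow ha hb rot_int_pow \<theta>_def \<phi>_def)
  have h1: "h \<one> = mat 1" using h.hom_one by (simp add: SO3_simps)
  have hmult: "h (x \<otimes> y) = h x ** h y" if "x \<in> carrier H" "y \<in> carrier H" for x y
    using h.hom_mult[OF that] by (simp add: SO3_simps)
  have hc: "h c = rot_x (\<theta> (int m))" and hd: "h d = rot_z (\<phi> (int n))"
    using hai[of "int m"] hbi[of "int n"] by (simp_all add: c_def d_def int_pow_int)
  have c_cases: "c = \<one> \<or> \<theta> (int m) = pi" and d_cases: "d = \<one> \<or> \<phi> (int n) = pi"
    using m_rel n_rel pos by (auto simp: c_def d_def \<theta>_def \<phi>_def)
  \<comment> \<open>The images of \<open>U\<close> are diagonal with entries 1 and -1. That only u =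
    1 is sent to the identity is recorded through the cosines.\<close>
  have hU: "\<exists>t r. h u = rot_x t ** rot_z r \<and> sin t = 0 \<and> sin r = 0 \<and> (cos t = 1 \<and> cos r = 1 \<longrightarrow> u = \<one>)"
    if u: "u \<in> {\<one>, c, d, c \<otimes> d}" for u
  proof -
    have *: "\<exists>t. h x = rot_x t \<and> sin t = 0 \<and> (cos t = 1 \<longrightarrow> x = \<one>)" if "x \<in> {\<one>, c}" for x
      using that c_cases hc h1 rot_zero by (metis cos_pi insertE one_neq_neg_one singletonD sin_pi sin_zero)
    have **: "\<exists>t. h x = rot_z t \<and> sin t = 0 \<and> (cos t = 1 \<longrightarrow> x = \<one>)" if "x \<in> {\<one>, d}" for x
      using that d_cases hd h1 rot_zero by (metis cos_pi insertE one_neq_neg_one singletonD sin_pi sin_zero)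
    obtain x y where xy: "x \<in> {\<one>, c}" "y \<in> {\<one>, d}" "u = x \<otimes> y"
      using u by force
    then have "x \<in> carrier H" "y \<in> carrier H" by auto
    then show ?thesis
      using *[OF xy(1)] **[OF xy(2)] xy(3) hmult by (metis r_one)
  qed

  obtain V where "dyadic_valuation_ring V" using dyadic_valuation_ring_exists by blast
  then interpret dyadic_valuation_ring V .
  \<comment> \<open>Since \<open>n\<close> is odd, exponents not divisible by it give neither half
    nor quarter turns about the z-axis. About the x-axis quarter turns can occur, whence the extra
    case in \<open>cos_\<theta>\<close>.\<close>
  have cos_\<phi>: "cos (\<phi> i) \<notin> V" if "\<not> int n dvd i" for i
    using cos_in_V_imp[of "\<phi> i" q i] sin_double_multiple_nonzero[OF pos(2) _ n that] n_rel pos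
    by (auto simp: \<phi>_def)
  have sin_\<theta>: "sin (\<theta> i) \<noteq> 0" if "\<not> int m dvd i" for i
    unfolding \<theta>_def by (rule sin_multiple_nonzero[OF pos(1) _ that]) (use m_rel in auto)
  have cos_\<theta>: "cos (\<theta> i) \<notin> V \<or> cos (\<theta> i) = 0" if "\<not> int m dvd i" for i
  proof -
    have "real p * \<theta> i = 2 * pi * of_int i" using pos by (simp add: \<theta>_def)
    then show ?thesis using cos_in_V_imp[OF _ pos(1)] sin_\<theta>[OF that] by (auto simp: sin_double)
  qed
  \<comment> \<open>\<open>e\<close> spans the x-axis and is fixed by the powers of
    \<open>a\<close>. A rightmost power of \<open>a\<close> is therefore invisible on it, and
    \<open>red\<close> has to single out the words that consist of one such power.\<close>
  define e :: "real^3" where "e = axis 1 1"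
  have rot_e: "rot_x t *v e = e" for t
    by (simp add: e_def vec_eq_iff forall_3 rot_x_nth) (simp add: axis_def)
  have hmv: "h (x \<otimes> y) *v e = h x *v (h y *v e)" if "x \<in> carrier H" "y \<in> carrier H" for x y
    by (simp add: that matrix_vector_mul_assoc SO3_simps(2))
  have red: "if s then w = \<one> \<or> in_span110 (h w *v e)
      else w = \<one> \<or> (\<exists>i. \<not> int m dvd i \<and> w = a [^] i) \<or> meets110 M (h w *v e)" if "reduced s w" for s w
    using that
  proof induction
    case (step s i w)
    have w: "w \<in> carrier H" using step.hyps by simp
    show ?case
    proof (cases s)
      case True
      then have i: "\<not> int m dvd i" using step.hyps by simp
      have "meets110 M (h (a [^] i \<otimes> w) *v e)" if "in_span110 (h w *v e)"
        using meets110_rot_x[OF cos_\<theta>[OF i] that] w by (simp add: hmv hai del: h.hom_mult)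
      moreover have "a [^] i \<otimes> w = a [^] i" if "w = \<one>" using that by simp
      ultimately show ?thesis using True step.IH i by auto
    next
      case False
      then have i: "\<not> int n dvd i" using step.hyps by simp
      have "meets110 V (h w *v e)"
        using step.IH False meets110_axis meets110_mono by (auto simp: hai rot_e SO3_simps(3) e_def[symmetric])
      then have "in_span110 (h (b [^] i \<otimes> w) *v e)"
        using in_span110_rot_z[OF cos_\<phi>[OF i]] w by (simp add: hmv hbi del: h.hom_mult)
      then show ?thesis using False by simp
    qed
  qed simp

  have "x = \<one>" if x: "x \<in> carrier H" and hx: "h x = \<one>\<^bsub>SO3\<^esub>" for x
  proof -
    obtain u s w where u: "u \<in> {\<one>, c, d, c \<otimes> d}" and w: "reduced s w" and xuw: "x = u \<otimes> w"
      using normal_form[OF x] by metis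
    have u': "inv u \<in> {\<one>, c, d, c \<otimes> d}" using subgroup.m_inv_closed[OF subgroup_U u] .
    have uc: "u \<in> carrier H" and wc: "w \<in> carrier H" using u w by auto
    have "w = inv u \<otimes> x" using xuw uc wc by (simp add: m_assoc[symmetric])
    then have "h w = h (inv u) \<otimes>\<^bsub>SO3\<^esub> \<one>\<^bsub>SO3\<^esub>" using x uc hx by simp
    then have hw: "h w = h (inv u)" using uc by simp
    obtain t r where tr: "h (inv u) = rot_x t ** rot_z r" "sin t = 0" "sin r = 0"
      using hU[OF u'] by blast
    \<comment> \<open>So \<open>h w\<close> sends \<open>e\<close> to itself or its negative, an
      integral vector, which \<open>not_integral\<close> excludes unless \<open>w\<close> is 1 or a
      power of \<open>a\<close>.\<close>
    have "cos r \<in> {1, - 1}" using tr(3) sin_cos_squared_add[of r] by (auto simp: power2_eq_1_iff)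
    then have "(h w *v e) $ 1 \<in> V" "(h w *v e) $ 2 \<in> V"
      using V(1,2,5) tr by (auto simp: e_def matrix_vector_mult_axis_nth hw rot_x_rot_z_nth)
    then have "w = \<one> \<or> (\<exists>i. \<not> int m dvd i \<and> w = a [^] i)"
      using red[OF w] not_integral[of "h w *v e"] by (auto split: if_splits)
    \<comment> \<open>The (3,2) entry detects what \<open>e\<close> does not see: it is sin(\<theta>
      i) for the power of \<open>a\<close>, but 0 for a product of half turns.\<close>
    moreover have False if "\<not> int m dvd i" "w = a [^] i" for i
    proof -
      have "rot_x (\<theta> i) ** rot_z 0 = rot_x t ** rot_z r"
        using hw that(2) by (simp add: hai tr(1) rot_zero)
      then have "sin (\<theta> i) = 0"
        using rot_x_rot_z_nth(4)[of "\<theta> i" 0] rot_x_rot_z_nth(4)[of t r] tr by simp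
      then show False using sin_\<theta>[OF that(1)] by simp
    qed
    ultimately have "w = \<one>" by blast
    then have xu: "x = u" using xuw uc by simp
    obtain t r where *: "h u = rot_x t ** rot_z r" "cos t = 1 \<and> cos r = 1 \<longrightarrow> u = \<one>"
      using hU[OF u] by blast
    have tr: "rot_x t ** rot_z r = mat 1" "cos t = 1 \<and> cos r = 1 \<longrightarrow> u = \<one>"
      using * xu hx by (simp_all add: SO3_simps)
    have "cos r = 1" using arg_cong[OF tr(1), of "\<lambda>Q. Q $ 1 $ 1"] by (simp add: rot_x_rot_z_nth mat_def)
    moreover have "cos t * cos r = 1" using arg_cong[OF tr(1), of "\<lambda>Q. Q $ 2 $ 2"] by (simp add: rot_x_rot_z_nth mat_def)
    ultimately show ?thesis using tr(2) xu by simp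
  qed
  then show ?thesis using h.inj_on_one_iff by blast
qed

lemma iso_onto_generate:
  assumes "group H" "group K" "h \<in> hom H K" "inj_on h (carrier H)"
    and X: "X \<subseteq> carrier H" and gen: "carrier H = generate H X"
  shows "h \<in> iso H (K\<lparr>carrier := generate K (h ` X)\<rparr>)"
proof -
  interpret group_hom H K h using assms by (simp add: group_hom_def group_hom_axioms_def)
  have "h ` carrier H = generate K (h ` X)" using generate_img[OF X] gen by simp
  then show ?thesis using assms by (auto simp: iso_def hom_def bij_betw_def)
qed

text \<open>Von Dyck's theorem supplies the homomorphism, and its image is the subgroup generated by
  the values of \<open>f\<close>; only injectivity is left to the user of the rule.\<close>

lemma has_presentation_viaI:
  assumes "group K" and f: "f \<in> S \<rightarrow> carrier K" and R: "\<And>r. r \<in> R \<Longrightarrow> word_eval K f r = \<one>\<^bsub>K\<^esub>"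
    and inj: "\<And>h. h \<in> hom (presented_group S R) K \<Longrightarrow> (\<And>x. x \<in> S \<Longrightarrow> h (word_class S R [(x, True)]) = f x)
      \<Longrightarrow> inj_on h (carrier (presented_group S R))"
  shows "has_presentation_via (K\<lparr>carrier := generate K (f ` S)\<rparr>) S R f"
proof -
  interpret K: group K by fact
  obtain h where h: "h \<in> hom (presented_group S R) K"
    "\<And>w. w \<in> words S \<Longrightarrow> h (word_class S R w) = word_eval K f w"
    using K.presented_group_hom[OF f R] by blast
  have hx: "h (word_class S R [(x, True)]) = f x" if "x \<in> S" for x
  proof -
    have "f x \<in> carrier K" using f that by auto
    then show ?thesis using h(2)[of "[(x, True)]"] that by (simp add: words_def)
  qed
  have "h ` (\<lambda>x. word_class S R [(x, True)]) ` S = f ` S" using hx by force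
  then have "h \<in> iso (presented_group S R) (K\<lparr>carrier := generate K (f ` S)\<rparr>)"
    using iso_onto_generate[OF group_presented_group K.is_group h(1) inj[OF h(1) hx] _ presented_group_generated]
    by (fastforce simp: carrier_presented_group words_def)
  then show ?thesis unfolding has_presentation_via_def using hx by blast
qed

section \<open>The groups \<open>G(p, q)\<close>\<close>

lemma word_class_gen_pow:
  assumes "x \<in> S"
  shows "word_class S R (gen_pow x n) = word_class S R [(x, True)] [^]\<^bsub>presented_group S R\<^esub> n"
proof -
  interpret group "presented_group S R" by (rule group_presented_group)
  have x: "[(x, True)] \<in> words S" and n: "gen_pow x n \<in> words S"
    using assms by (auto simp: words_def gen_pow_def)
  then have "word_class S R [(x, True)] \<in> carrier (presented_group S R)"
    by (simp add: carrier_presented_group)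
  then show ?thesis
    using word_class_eq_word_eval[OF n, of R] word_eval_gen_pow by metis
qed

lemma words_gen_pow: "x \<in> S \<Longrightarrow> gen_pow x n \<in> words S"
  by (auto simp: words_def gen_pow_def)

lemma words_append: "v \<in> words S \<Longrightarrow> w \<in> words S \<Longrightarrow> v @ w \<in> words S"
  by (auto simp: words_def)

lemma word_class_swap_relator:
  assumes "x \<in> S" "y \<in> S" "gen_pow x m @ gen_pow y 1 @ gen_pow x m @ gen_pow y 1 \<in> R"
  defines "P \<equiv> presented_group S R" and "a \<equiv> word_class S R [(x, True)]" and "b \<equiv> word_class S R [(y, True)]"
  shows "a [^]\<^bsub>P\<^esub> m \<otimes>\<^bsub>P\<^esub> (b \<otimes>\<^bsub>P\<^esub> (a [^]\<^bsub>P\<^esub> m \<otimes>\<^bsub>P\<^esub> b)) = \<one>\<^bsub>P\<^esub>"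
proof -
  interpret group P unfolding P_def by (rule group_presented_group)
  have b: "b = word_class S R (gen_pow y 1)"
    by (simp add: b_def gen_pow_def)
  show ?thesis
    unfolding b a_def P_def word_class_gen_pow[OF assms(1), symmetric]
    by (simp add: mult_word_class words_gen_pow words_append assms(1,2) del: One_nat_def)
      (intro word_class_relator assms(3) words_append words_gen_pow assms(1,2))
qed

lemma (in group) swap_relator_imp:
  assumes "c \<in> carrier G" "b \<in> carrier G" "c \<otimes> c = \<one>" "c \<otimes> (b \<otimes> (c \<otimes> b)) = \<one>"
  shows "b \<otimes> c = c \<otimes> inv b"
proof -
  have "b \<otimes> (c \<otimes> b) = c \<otimes> (c \<otimes> (b \<otimes> (c \<otimes> b)))"
    using assms(1-3) by (simp add: m_assoc[symmetric])
  then have "b \<otimes> c \<otimes> b = c" using assms by (simp add: m_assoc)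
  then show ?thesis using assms(1,2) by (metis inv_solve_right m_closed)
qed

text \<open>A half turn reverses a perpendicular axis, so conjugation by it inverts the rotations
  about that axis.\<close>

lemma rot_half_turn_swap:
  "rot_x pi ** (rot_z t ** (rot_x pi ** rot_z t)) = mat 1" "rot_z pi ** (rot_x t ** (rot_z pi ** rot_x t)) = mat 1"
  using sin_cos_squared_add3[of t]
  by (simp_all add: rot_x_def rot_z_def vec_eq_iff forall_3 matrix_matrix_mult_def sum_3 mat_def add.commute)

lemma rot_full_pow:
  assumes "p > 0"
  shows "rot_x (2 * pi / real p) [^]\<^bsub>SO3\<^esub> p = \<one>\<^bsub>SO3\<^esub>" "rot_z (2 * pi / real p) [^]\<^bsub>SO3\<^esub> p = \<one>\<^bsub>SO3\<^esub>"
proof -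
  have "rot_x (2 * pi) = mat 1" "rot_z (2 * pi) = mat 1"
    by (simp_all add: rot_x_def rot_z_def vec_eq_iff forall_3 mat_def)
  then show "rot_x (2 * pi / real p) [^]\<^bsub>SO3\<^esub> p = \<one>\<^bsub>SO3\<^esub>"
    "rot_z (2 * pi / real p) [^]\<^bsub>SO3\<^esub> p = \<one>\<^bsub>SO3\<^esub>"
    using assms by (simp_all add: rot_nat_pow SO3_simps)
qed

text \<open>Three presentations in one: choosing m = p or m = p/2, and n = q or n = q/2, decides
  which of the half turn relators are present.\<close>

lemma presentation:
  fixes p q m n :: nat
  assumes pos: "p > 0" "q > 0" and n: "odd n"
    and p: "p = m \<and> odd m \<or> p = 2 * m" and q: "q = n \<or> q = 2 * n"
    and R: "R = {gen_pow Alpha p, gen_pow Beta q}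
      \<union> (if p = m then {} else {gen_pow Alpha m @ gen_pow Beta 1 @ gen_pow Alpha m @ gen_pow Beta 1})
      \<union> (if q = n then {} else {gen_pow Beta n @ gen_pow Alpha 1 @ gen_pow Beta n @ gen_pow Alpha 1})"
  defines "A \<equiv> rot_x (2 * pi / real p)" and "B \<equiv> rot_z (2 * pi / real q)"
  shows "has_presentation_via (SO3\<lparr>carrier := rot_group p 1 q\<rparr>) {Alpha, Beta} R (case_generator A B)"
proof -
  interpret SO3: group SO3 by (rule group_SO3)
  let ?S = "{Alpha, Beta}" and ?f = "case_generator A B"
  let ?P = "presented_group ?S R"
  interpret P: group ?P by (rule group_presented_group)
  define a b where "a = word_class ?S R [(Alpha, True)]" and "b = word_class ?S R [(Beta, True)]"
  have AB [simp]: "A \<in> carrier SO3" "B \<in> carrier SO3" by (simp_all add: A_def B_def rot_in_SO3)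
  have f: "?f \<in> ?S \<rightarrow> carrier SO3" by auto
  have mA: "A [^]\<^bsub>SO3\<^esub> m = rot_x pi" if "p = 2 * m"
    using that pos by (simp add: A_def rot_nat_pow)
  have nB: "B [^]\<^bsub>SO3\<^esub> n = rot_z pi" if "q = 2 * n"
    using that pos by (simp add: B_def rot_nat_pow)
  have rels: "word_eval SO3 ?f r = \<one>\<^bsub>SO3\<^esub>" if rR: "r \<in> R" for r
  proof -
    have *: "word_eval SO3 ?f (gen_pow x i @ gen_pow y 1 @ gen_pow x i @ gen_pow y 1) =
        ?f x [^]\<^bsub>SO3\<^esub> i \<otimes>\<^bsub>SO3\<^esub> (?f y \<otimes>\<^bsub>SO3\<^esub> (?f x [^]\<^bsub>SO3\<^esub> i \<otimes>\<^bsub>SO3\<^esub> ?f y))"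
      if "x \<in> ?S" "y \<in> ?S" for x y i
    proof -
      have "?f x \<in> carrier SO3" "?f y \<in> carrier SO3" using that by auto
      then show ?thesis
        using that by (simp add: SO3.word_eval_append[OF f] SO3.word_eval_gen_pow words_gen_pow words_append del: One_nat_def) simp
    qed
    consider "r = gen_pow Alpha p" | "r = gen_pow Beta q"
      | "p = 2 * m" "r = gen_pow Alpha m @ gen_pow Beta 1 @ gen_pow Alpha m @ gen_pow Beta 1"
      | "q = 2 * n" "r = gen_pow Beta n @ gen_pow Alpha 1 @ gen_pow Beta n @ gen_pow Alpha 1"
      using rR p q unfolding R by (auto split: if_splits)
    then show ?thesis
    proof cases
      case 1
      then show ?thesis using rot_full_pow(1)[OF pos(1)] by (simp add: SO3.word_eval_gen_pow A_def[symmetric])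
    next
      case 2
      then show ?thesis using rot_full_pow(2)[OF pos(2)] by (simp add: SO3.word_eval_gen_pow B_def[symmetric])
    next
      case 3
      have "word_eval SO3 ?f r = A [^]\<^bsub>SO3\<^esub> m \<otimes>\<^bsub>SO3\<^esub> (B \<otimes>\<^bsub>SO3\<^esub> (A [^]\<^bsub>SO3\<^esub> m \<otimes>\<^bsub>SO3\<^esub> B))"
        using *[of Alpha Beta m] 3(2) by simp
      also have "\<dots> = \<one>\<^bsub>SO3\<^esub>"
        unfolding mA[OF 3(1)] by (simp add: SO3_simps B_def rot_half_turn_swap)
      finally show ?thesis .
    next
      case 4
      have "word_eval SO3 ?f r = B [^]\<^bsub>SO3\<^esub> n \<otimes>\<^bsub>SO3\<^esub> (A \<otimes>\<^bsub>SO3\<^esub> (B [^]\<^bsub>SO3\<^esub> n \<otimes>\<^bsub>SO3\<^esub> A))"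
        using *[of Beta Alpha n] 4(2) by simp
      also have "\<dots> = \<one>\<^bsub>SO3\<^esub>"
        unfolding nB[OF 4(1)] by (simp add: SO3_simps A_def rot_half_turn_swap)
      finally show ?thesis .
    qed
  qed
  have ab: "a \<in> carrier ?P" "b \<in> carrier ?P"
    by (auto simp: a_def b_def carrier_presented_group words_def)
  have ap: "a [^]\<^bsub>?P\<^esub> p = \<one>\<^bsub>?P\<^esub>" and bq: "b [^]\<^bsub>?P\<^esub> q = \<one>\<^bsub>?P\<^esub>"
    unfolding a_def b_def by (subst word_class_gen_pow[symmetric]; (intro word_class_relator words_gen_pow)?; simp add: R)+
  have a2: "a [^]\<^bsub>?P\<^esub> m \<otimes>\<^bsub>?P\<^esub> a [^]\<^bsub>?P\<^esub> m = \<one>\<^bsub>?P\<^esub>" if "p = 2 * m"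
    using ap that ab by (simp add: P.nat_pow_mult mult_2)
  have b2: "b [^]\<^bsub>?P\<^esub> n \<otimes>\<^bsub>?P\<^esub> b [^]\<^bsub>?P\<^esub> n = \<one>\<^bsub>?P\<^esub>" if "q = 2 * n"
    using bq that ab by (simp add: P.nat_pow_mult mult_2)
  have ba: "b \<otimes>\<^bsub>?P\<^esub> a [^]\<^bsub>?P\<^esub> m = a [^]\<^bsub>?P\<^esub> m \<otimes>\<^bsub>?P\<^esub> inv\<^bsub>?P\<^esub> b" if "p = 2 * m"
    using that pos ab a2 unfolding a_def b_def
    by (intro P.swap_relator_imp word_class_swap_relator P.nat_pow_closed) (auto simp: R)
  have ab': "a \<otimes>\<^bsub>?P\<^esub> b [^]\<^bsub>?P\<^esub> n = b [^]\<^bsub>?P\<^esub> n \<otimes>\<^bsub>?P\<^esub> inv\<^bsub>?P\<^esub> a" if "q = 2 * n"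
    using that pos ab b2 unfolding a_def b_def
    by (intro P.swap_relator_imp word_class_swap_relator P.nat_pow_closed) (auto simp: R)
  have gen: "carrier ?P = generate ?P {a, b}"
    using presented_group_generated[of ?S R] by (simp add: a_def b_def)
  have "has_presentation_via (SO3\<lparr>carrier := generate SO3 (?f ` ?S)\<rparr>) ?S R ?f"
  proof (rule has_presentation_viaI[OF SO3.is_group f rels])
    fix h assume h: "h \<in> hom ?P SO3" and hx: "\<And>x. x \<in> ?S \<Longrightarrow> h (word_class ?S R [(x, True)]) = ?f x"
    have "h a = A" "h b = B" using hx[of Alpha] hx[of Beta] by (simp_all add: a_def b_def)
    then show "inj_on h (carrier ?P)"
      using ap bq a2 b2 ba ab' p q
      by (intro rotation_hom_injective[OF P.is_group h ab gen _ _ pos n, of m]) (auto simp: A_def B_def)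
  qed
  then show ?thesis unfolding rot_group_two_generators by (simp add: A_def B_def)
qed

section \<open>The free product of two cyclic groups of odd order\<close>

lemma pow_of_cyclic_addition_table:
  fixes p :: nat and e :: "int \<Rightarrow> 'g"
  assumes "group H" and p: "p > 1" and e: "\<And>x. 0 \<le> x \<Longrightarrow> x < int p \<Longrightarrow> e x \<in> carrier H"
    and mult: "\<And>x y. 0 \<le> x \<Longrightarrow> x < int p \<Longrightarrow> 0 \<le> y \<Longrightarrow> y < int p \<Longrightarrow> e x \<otimes>\<^bsub>H\<^esub> e y = e ((x + y) mod int p)"
  shows "e 1 [^]\<^bsub>H\<^esub> (k :: nat) = e (int k mod int p)"
proof (induction k)
  interpret group H by fact
  have "e 0 \<otimes>\<^bsub>H\<^esub> e 0 = e 0" using mult[of 0 0] p by simp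
  then have "e 0 = \<one>\<^bsub>H\<^esub>" using e[of 0] p by (simp add: l_cancel_one)
  case 0
  then show ?case using \<open>e 0 = \<one>\<^bsub>H\<^esub>\<close> by simp
next
  case (Suc k)
  then show ?case using mult[of "int k mod int p" 1] p by (simp add: mod_add_left_eq mod_add_right_eq add.commute)
qed

text \<open>In \<open>free_product\<close> every element of a factor is a letter and the relators
  are the multiplication tables. The tables make each letter a power of the letter for 1, so two
  elements generate, and \<open>rotation_hom_injective\<close> applies with m = p and n = q.\<close>

lemma iso_free_product:
  fixes p q :: nat
  assumes p: "p > 1" "odd p" and q: "q > 1" "odd q"
  shows "SO3\<lparr>carrier := rot_group p 1 q\<rparr> \<cong> free_product (integer_mod_group p) (integer_mod_group q)"
proof -
  interpret SO3: group SO3 by (rule group_SO3)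
  let ?S = "carrier (integer_mod_group p) <+> carrier (integer_mod_group q)"
  define R where "R = {[(Inl x, True), (Inl y, True), (Inl (x \<otimes>\<^bsub>integer_mod_group p\<^esub> y), False)] | x y.
        x \<in> carrier (integer_mod_group p) \<and> y \<in> carrier (integer_mod_group p)} \<union>
      {[(Inr x, True), (Inr y, True), (Inr (x \<otimes>\<^bsub>integer_mod_group q\<^esub> y), False)] | x y.
        x \<in> carrier (integer_mod_group q) \<and> y \<in> carrier (integer_mod_group q)}"
  let ?P = "presented_group ?S R"
  have P: "?P = free_product (integer_mod_group p) (integer_mod_group q)"
    by (simp add: free_product_def R_def)
  interpret P: group ?P by (rule group_presented_group)
  define A B where "A = rot_x (2 * pi / real p)" and "B = rot_z (2 * pi / real q)"
  have AB [simp]: "A \<in> carrier SO3" "B \<in> carrier SO3" by (simp_all add: A_def B_def rot_in_SO3)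
  have Ap: "A [^]\<^bsub>SO3\<^esub> int p = \<one>\<^bsub>SO3\<^esub>" and Bq: "B [^]\<^bsub>SO3\<^esub> int q = \<one>\<^bsub>SO3\<^esub>"
    using rot_full_pow p q by (simp_all add: A_def B_def int_pow_int)
  define f where "f = case_sum (\<lambda>i :: int. A [^]\<^bsub>SO3\<^esub> i) (\<lambda>i :: int. B [^]\<^bsub>SO3\<^esub> i)"
  have f: "f \<in> ?S \<rightarrow> carrier SO3" by (auto simp: f_def)
  have table: "Q [^]\<^bsub>SO3\<^esub> x \<otimes>\<^bsub>SO3\<^esub> (Q [^]\<^bsub>SO3\<^esub> y \<otimes>\<^bsub>SO3\<^esub> inv\<^bsub>SO3\<^esub> (Q [^]\<^bsub>SO3\<^esub> ((x + y) mod k))) = \<one>\<^bsub>SO3\<^esub>"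
    if Q: "Q \<in> carrier SO3" "Q [^]\<^bsub>SO3\<^esub> k = \<one>\<^bsub>SO3\<^esub>" for Q and x y k :: int
  proof -
    have "Q [^]\<^bsub>SO3\<^esub> (x + y) = Q [^]\<^bsub>SO3\<^esub> (k * ((x + y) div k) + (x + y) mod k)" by simp
    also have "\<dots> = (Q [^]\<^bsub>SO3\<^esub> k) [^]\<^bsub>SO3\<^esub> ((x + y) div k) \<otimes>\<^bsub>SO3\<^esub> Q [^]\<^bsub>SO3\<^esub> ((x + y) mod k)"
      using Q(1) by (simp only: SO3.int_pow_mult SO3.int_pow_pow)
    finally have "Q [^]\<^bsub>SO3\<^esub> (x + y) = Q [^]\<^bsub>SO3\<^esub> ((x + y) mod k)" using Q by simp
    then show ?thesis using Q(1) by (simp add: SO3.m_assoc[symmetric] SO3.int_pow_mult[symmetric])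
  qed
  have "word_eval SO3 f r = \<one>\<^bsub>SO3\<^esub>" if "r \<in> R" for r
    using that p q table[OF AB(1) Ap] table[OF AB(2) Bq]
    by (auto simp: R_def f_def mult_integer_mod_group)
  then obtain h where h: "h \<in> hom ?P SO3" "\<And>w. w \<in> words ?S \<Longrightarrow> h (word_class ?S R w) = word_eval SO3 f w"
    using SO3.presented_group_hom[OF f] by blast
  define l r where "l x = word_class ?S R [(Inl x, True)]" and "r x = word_class ?S R [(Inr x, True)]" for x
  have S: "Inl x \<in> ?S \<longleftrightarrow> 0 \<le> x \<and> x < int p" "Inr x \<in> ?S \<longleftrightarrow> 0 \<le> x \<and> x < int q" for x
    using p q by (auto simp: carrier_integer_mod_group)
  have closed: "l x \<in> carrier ?P" if "0 \<le> x" "x < int p" for x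
    using that S by (auto simp: l_def carrier_presented_group words_def)
  have closed': "r x \<in> carrier ?P" if "0 \<le> x" "x < int q" for x
    using that S by (auto simp: r_def carrier_presented_group words_def)
  have rel: "word_class ?S R [(x, True)] \<otimes>\<^bsub>?P\<^esub> word_class ?S R [(y, True)] = word_class ?S R [(z, True)]"
    if "x \<in> ?S" "y \<in> ?S" "z \<in> ?S" "[(x, True), (y, True), (z, False)] \<in> R" for x y z
  proof -
    let ?c = "\<lambda>x. word_class ?S R [(x, True)]"
    have w: "[(x, True), (y, True), (z, False)] \<in> words ?S" using that by (auto simp: words_def)
    have c: "?c x \<in> carrier ?P" "?c y \<in> carrier ?P" "?c z \<in> carrier ?P"
      using that by (auto simp: carrier_presented_group words_def)
    have "?c x \<otimes>\<^bsub>?P\<^esub> (?c y \<otimes>\<^bsub>?P\<^esub> inv\<^bsub>?P\<^esub> ?c z) = \<one>\<^bsub>?P\<^esub>"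
      using word_class_eq_word_eval[OF w, of R] word_class_relator[OF that(4) w] c by simp
    then have "(?c x \<otimes>\<^bsub>?P\<^esub> ?c y) \<otimes>\<^bsub>?P\<^esub> inv\<^bsub>?P\<^esub> ?c z = \<one>\<^bsub>?P\<^esub>" using c by (simp add: P.m_assoc)
    then show ?thesis using c P.inv_equality[of "?c x \<otimes>\<^bsub>?P\<^esub> ?c y" "inv\<^bsub>?P\<^esub> ?c z"] by simp
  qed
  have lpow: "l 1 [^]\<^bsub>?P\<^esub> k = l (int k mod int p)" for k
  proof (rule pow_of_cyclic_addition_table[OF P.is_group p(1) closed])
    fix x y assume "0 \<le> x" "x < int p" "0 \<le> y" "y < int p"
    then show "l x \<otimes>\<^bsub>?P\<^esub> l y = l ((x + y) mod int p)"
      unfolding l_def using p by (intro rel) (auto simp: S R_def mult_integer_mod_group carrier_integer_mod_group)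
  qed
  have rpow: "r 1 [^]\<^bsub>?P\<^esub> k = r (int k mod int q)" for k
  proof (rule pow_of_cyclic_addition_table[OF P.is_group q(1) closed'])
    fix x y assume "0 \<le> x" "x < int q" "0 \<le> y" "y < int q"
    then show "r x \<otimes>\<^bsub>?P\<^esub> r y = r ((x + y) mod int q)"
      unfolding r_def using q by (intro rel) (auto simp: S R_def mult_integer_mod_group carrier_integer_mod_group)
  qed
  have lr: "l 1 \<in> carrier ?P" "r 1 \<in> carrier ?P" using closed closed' p q by auto
  have gen: "carrier ?P = generate ?P {l 1, r 1}"
  proof
    have sub: "subgroup (generate ?P {l 1, r 1}) ?P" using lr by (intro P.generate_is_subgroup) auto
    have incl: "l 1 \<in> generate ?P {l 1, r 1}" "r 1 \<in> generate ?P {l 1, r 1}"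
      by (auto intro: generate.incl)
    have "word_class ?S R [(x, True)] \<in> generate ?P {l 1, r 1}" if x: "x \<in> ?S" for x
    proof (cases x)
      case (Inl i)
      then have i: "0 \<le> i" "i < int p" using x S by auto
      then have "l 1 [^]\<^bsub>?P\<^esub> nat i = l i" by (simp add: lpow)
      then have "l 1 [^]\<^bsub>?P\<^esub> nat i = word_class ?S R [(x, True)]" by (simp only: l_def Inl)
      then show ?thesis using P.subgroup_int_pow_closed[OF sub incl(1), of "int (nat i)"] by (simp only: int_pow_int)
    next
      case (Inr i)
      then have i: "0 \<le> i" "i < int q" using x S by auto
      then have "r 1 [^]\<^bsub>?P\<^esub> nat i = r i" by (simp add: rpow)
      then have "r 1 [^]\<^bsub>?P\<^esub> nat i = word_class ?S R [(x, True)]" by (simp only: r_def Inr)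
      then show ?thesis using P.subgroup_int_pow_closed[OF sub incl(2), of "int (nat i)"] by (simp only: int_pow_int)
    qed
    then show "carrier ?P \<subseteq> generate ?P {l 1, r 1}"
      unfolding presented_group_generated by (intro P.generate_subgroup_incl[OF _ sub]) auto
    show "generate ?P {l 1, r 1} \<subseteq> carrier ?P" using lr by (intro P.generate_incl) auto
  qed
  have one: "l 0 = \<one>\<^bsub>?P\<^esub>" "r 0 = \<one>\<^bsub>?P\<^esub>" using lpow[of 0] rpow[of 0] by simp_all
  have hl: "h (l 1) = A" "h (r 1) = B"
    using p q S by (simp_all add: l_def r_def h(2) words_def f_def)
  have "inj_on h (carrier ?P)"
    using p q lpow[of p] rpow[of q] one hl
    by (intro rotation_hom_injective[OF P.is_group h(1) lr gen, of p q q p]) (auto simp: A_def B_def)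
  then have "h \<in> iso ?P (SO3\<lparr>carrier := generate SO3 (h ` {l 1, r 1})\<rparr>)"
    using lr gen by (intro iso_onto_generate P.is_group SO3.is_group h(1)) auto
  then have "h \<in> iso ?P (SO3\<lparr>carrier := rot_group p 1 q\<rparr>)"
    unfolding rot_group_two_generators by (simp add: hl A_def B_def)
  then have "?P \<cong> SO3\<lparr>carrier := rot_group p 1 q\<rparr>" by (auto simp: is_iso_def)
  then show ?thesis unfolding P[symmetric] by (rule P.iso_sym)
qed

section \<open>Quarter turns permuting the axes, and the case of orders divisible by 4\<close>

lemma rot_conj:
  "rot_x (- (pi / 2)) ** (rot_z t ** rot_x (pi / 2)) = rot_y t"
  "rot_y (- (pi / 2)) ** (rot_x t ** rot_y (pi / 2)) = rot_z t"
  "rot_y (pi / 2) ** (rot_z t ** rot_y (- (pi / 2))) = rot_x t"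
  by (simp_all add: rot_x_def rot_y_def rot_z_def vec_eq_iff forall_3 matrix_matrix_mult_def sum_3)

text \<open>On the right, the quarter turn about y carries x-rotations of order q to the z-axis. On
  the left, the quarter turns about x and z are powers of the generators and yield the one about y;
  this carries the z-rotation of order q to the x-axis, where it is combined with the one of order
  p.\<close>

lemma rot_group_lcm:
  assumes pos: "p > 0" "q > 0" and dvd: "4 dvd p" "4 dvd q"
  shows "rot_group p 1 q = rot_group (lcm p q) 4 1"
proof -
  interpret group SO3 by (rule group_SO3)
  note K1 = subgroup_rot_group[of p 1 q] and K2 = subgroup_rot_group[of "lcm p q" 4 1]
  have mult: "x ** y \<in> rot_group i j k" if "x \<in> rot_group i j k" "y \<in> rot_group i j k" for x y i j k
    using subgroup.m_closed[OF subgroup_rot_group that] by (simp add: SO3_simps)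
  have pow: "rot_x (of_int l * t) \<in> rot_group i j k" if "rot_x t \<in> rot_group i j k" for l t i j k
    using subgroup_int_pow_closed[OF subgroup_rot_group that, of l] by (simp add: rot_int_pow)
  have powz: "rot_z (of_int l * t) \<in> rot_group i j k" if "rot_z t \<in> rot_group i j k" for l t i j k
    using subgroup_int_pow_closed[OF subgroup_rot_group that, of l] by (simp add: rot_int_pow)
  have gens: "rot_x (2 * pi / real i) \<in> rot_group i j k" "rot_y (2 * pi / real j) \<in> rot_group i j k"
    "rot_z (2 * pi / real k) \<in> rot_group i j k" for i j k
    by (auto simp: rot_group_def intro: generate.incl)
  have one: "mat 1 \<in> rot_group i j k" for i j k
    using subgroup.one_closed[OF subgroup_rot_group] by (simp add: SO3_simps)
  have full: "rot_y (2 * pi / real 1) = mat 1" "rot_z (2 * pi / real 1) = mat 1"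
    by (simp_all add: rot_y_def rot_z_def vec_eq_iff forall_3 mat_def)
  have "inv\<^bsub>SO3\<^esub> rot_y t = rot_y (- t)" for t
  proof (intro inv_equality rot_in_SO3)
    show "rot_y (- t) \<otimes>\<^bsub>SO3\<^esub> rot_y t = \<one>\<^bsub>SO3\<^esub>"
      using sin_cos_squared_add3[of t]
      by (simp add: SO3_simps rot_y_def vec_eq_iff forall_3 mat_def matrix_matrix_mult_def sum_3 add.commute)
  qed
  then have inv_y: "rot_y (- t) \<in> rot_group i j k" if "rot_y t \<in> rot_group i j k" for t i j k
    using subgroup.m_inv_closed[OF subgroup_rot_group that] by simp
  have L: "lcm p q > 0" using pos by (simp add: lcm_pos_nat)
  show ?thesis
  proof
    have y: "rot_y (pi / 2) \<in> rot_group (lcm p q) 4 1"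
      using gens(2)[where j = 4] by simp
    have x: "rot_x (2 * pi / real r) \<in> rot_group (lcm p q) 4 1" if "r dvd lcm p q" for r
    proof -
      obtain k where k: "lcm p q = r * k" using \<open>r dvd lcm p q\<close> by blast
      have "r > 0" "k > 0" using L k by (auto intro: gr0I)
      then have "2 * pi / real r = of_int (int k) * (2 * pi / real (lcm p q))" by (simp add: k)
      then show ?thesis using pow[OF gens(1)] by metis
    qed
    have "rot_z (2 * pi / real q) \<in> rot_group (lcm p q) 4 1"
      unfolding rot_conj(2)[symmetric] by (intro mult x inv_y y) simp
    then show "rot_group p 1 q \<subseteq> rot_group (lcm p q) 4 1"
      unfolding rot_group_def[of p] using x[of p] one full by (intro generate_subgroup_incl[OF _ K2]) auto
  next
    obtain i where i: "p = 4 * i" using dvd(1) by blast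
    obtain j where j: "q = 4 * j" using dvd(2) by blast
    have "i > 0" "j > 0" using i j pos by auto
    then have "of_int (int i) * (2 * pi / real p) = pi / 2" "of_int (int j) * (2 * pi / real q) = pi / 2"
      "of_int (- int i) * (2 * pi / real p) = - (pi / 2)"
      by (simp_all add: i j)
    then have "rot_x (pi / 2) \<in> rot_group p 1 q" "rot_x (- (pi / 2)) \<in> rot_group p 1 q"
      "rot_z (pi / 2) \<in> rot_group p 1 q"
      using pow[OF gens(1)[of p 1 q]] powz[OF gens(3)[where k=q, of p 1]] by metis+
    then have y: "rot_y (pi / 2) \<in> rot_group p 1 q"
      unfolding rot_conj(1)[symmetric] by (intro mult)
    have xq: "rot_x (2 * pi / real q) \<in> rot_group p 1 q"
      unfolding rot_conj(3)[symmetric] by (intro mult y inv_y gens)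
    \<comment> \<open>With gcd(p, q) = u p + v q, the identity lcm * gcd = p q gives 1/lcm = v/p +
      u/q; the coefficients change places.\<close>
    obtain u v where uv: "u * int p + v * int q = gcd (int p) (int q)" using bezout_int by blast
    have "real (lcm p q) * real (gcd p q) = real p * real q"
      by (metis of_nat_mult mult.commute prod_gcd_lcm_nat)
    moreover have "real (gcd p q) = of_int u * real p + of_int v * real q"
    proof -
      have "real_of_int (u * int p + v * int q) = real_of_int (int (gcd p q))" unfolding uv by simp
      then show ?thesis by simp
    qed
    ultimately have eq: "real (lcm p q) * (of_int u * real p + of_int v * real q) = real p * real q" by simp
    then have nz: "of_int u * real p + of_int v * real q \<noteq> 0" using pos by auto
    have "2 * pi / real (lcm p q) = 2 * pi * (of_int u * real p + of_int v * real q)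
        / (real (lcm p q) * (of_int u * real p + of_int v * real q))" using nz by simp
    also have "\<dots> = of_int v * (2 * pi / real p) + of_int u * (2 * pi / real q)"
      unfolding eq using pos by (simp add: field_simps)
    finally have "2 * pi / real (lcm p q) = of_int v * (2 * pi / real p) + of_int u * (2 * pi / real q)" .
    then have "rot_x (2 * pi / real (lcm p q)) = rot_x (of_int v * (2 * pi / real p)) ** rot_x (of_int u * (2 * pi / real q))"
      by (simp add: rot_add)
    then have "rot_x (2 * pi / real (lcm p q)) \<in> rot_group p 1 q"
      using mult[OF pow[OF gens(1)] pow[OF xq]] by metis
    then show "rot_group (lcm p q) 4 1 \<subseteq> rot_group p 1 q"
      unfolding rot_group_def[of "lcm p q"] using y one full by (intro generate_subgroup_incl[OF _ K1]) auto
  qed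
qed

theorem theorem1:
  fixes p q :: nat
    and A B :: "real^3^3"
    and G :: "(real^3^3) monoid"
  assumes "p > 0" and "q > 0"
  defines "A \<equiv> rot_x (2 * pi / real p)"
    and "B \<equiv> rot_z (2 * pi / real q)"
    and "G \<equiv> SO3\<lparr>carrier := rot_group p 1 q\<rparr>"
  shows
    "(p \<ge> 3 \<and> odd p \<and> q \<ge> 3 \<and> odd q \<longrightarrow>
        G \<cong> free_product (integer_mod_group p) (integer_mod_group q) \<and>
        has_presentation_via G {Alpha, Beta}
          {gen_pow Alpha p, gen_pow Beta q}
          (case_generator A B))
   \<and> (p \<ge> 4 \<and> even p \<and> q \<ge> 3 \<and> odd q \<longrightarrow>
        has_presentation_via G {Alpha, Beta}
          {gen_pow Alpha p, gen_pow Beta q,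
           gen_pow Alpha (p div 2) @ gen_pow Beta 1 @ gen_pow Alpha (p div 2) @ gen_pow Beta 1}
          (case_generator A B))
   \<and> (\<forall>s. p \<ge> 4 \<and> even p \<and> q = 2 * s \<and> s \<ge> 3 \<and> odd s \<longrightarrow>
        has_presentation_via G {Alpha, Beta}
          {gen_pow Alpha p, gen_pow Beta q,
           gen_pow Alpha (p div 2) @ gen_pow Beta 1 @ gen_pow Alpha (p div 2) @ gen_pow Beta 1,
           gen_pow Beta (q div 2) @ gen_pow Alpha 1 @ gen_pow Beta (q div 2) @ gen_pow Alpha 1}
          (case_generator A B))
   \<and> (4 dvd p \<and> 4 dvd q \<longrightarrow>
        rot_group p 1 q = rot_group (lcm p q) 4 1)"
proof (intro conjI impI allI; (elim conjE)?)
  assume "3 \<le> p" "odd p" "3 \<le> q" "odd q"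
  then show "G \<cong> free_product (integer_mod_group p) (integer_mod_group q)"
    unfolding G_def by (intro iso_free_product) auto
next
  assume "3 \<le> p" "odd p" "3 \<le> q" "odd q"
  then show "has_presentation_via G {Alpha, Beta} {gen_pow Alpha p, gen_pow Beta q} (case_generator A B)"
    unfolding G_def A_def B_def by (intro presentation[where m = p and n = q] assms(1,2)) auto
next
  assume *: "4 \<le> p" "even p" "3 \<le> q" "odd q"
  show "has_presentation_via G {Alpha, Beta}
      {gen_pow Alpha p, gen_pow Beta q,
       gen_pow Alpha (p div 2) @ gen_pow Beta 1 @ gen_pow Alpha (p div 2) @ gen_pow Beta 1}
      (case_generator A B)"
    unfolding G_def A_def B_def
    by (intro presentation[where m = "p div 2" and n = q] assms(1,2)) (use * in \<open>auto simp del: One_nat_def\<close>)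
next
  fix s assume *: "4 \<le> p" "even p" "q = 2 * s" "3 \<le> s" "odd s"
  then show "has_presentation_via G {Alpha, Beta}
      {gen_pow Alpha p, gen_pow Beta q,
       gen_pow Alpha (p div 2) @ gen_pow Beta 1 @ gen_pow Alpha (p div 2) @ gen_pow Beta 1,
       gen_pow Beta (q div 2) @ gen_pow Alpha 1 @ gen_pow Beta (q div 2) @ gen_pow Alpha 1}
      (case_generator A B)"
    unfolding G_def A_def B_def
    by (intro presentation[where m = "p div 2" and n = s] assms(1,2)) (auto simp del: One_nat_def)
next
  assume "4 dvd p" "4 dvd q"
  then show "rot_group p 1 q = rot_group (lcm p q) 4 1" by (rule rot_group_lcm[OF assms(1,2)])
qed

end
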